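(* Let $d\ge 1$ be an integer and let $\mathbb{T}_{d+1}$ be the rooted homogeneous $(d+1)$-regular tree with root $o$. Then $$E (\varphi)\geq \|\varphi\|_{w_0}^2, \qquad \varphi \in C_c(\mathbb{T}_{d+1}\setminus \{o\}),$$ with optimal weight (optimal Hardy weight of $-\Delta$ on $\Omega=\mathbb{T}_{d+1}\setminus\{o\}$) $$ w_0(x)=w_0(r):= \lambda_0(\mathbb{T}_{d+1}) + \sqrt{d}\left(2-\sqrt{1-\frac{1}{r}}-\sqrt{1+\frac{1}{r}}\right), \qquad r\geq 1,$$ where $r$ is the combinatorial distance of the vertex $x$ from $o$. In particular, for all $r\geq 2$, $$ w_0(r)= \lambda_0(\mathbb{T}_{d+1}) +\frac{\sqrt{d}}{4 r^2} + 2 \sqrt{d} \sum_{n\in\{4,6,8,\dots\}}\binom{2n}{n}\frac{1}{2^{2n}(2n-1)}\frac{1}{r^n}.$$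
   Context: Tree. $\mathbb{T}_{d+1}$ is the infinite rooted tree in which the root $o$ has exactly $d$ neighbours (children) and every other vertex has exactly one parent and $d$ children. Write $X=\mathbb{T}_{d+1}$ for the vertex set, $b(x,y)=1$ if $x,y$ are neighbours and $b(x,y)=0$ otherwise, and let the vertex measure be $m\equiv 1$. For $d=1$ this is the standard line graph on $\mathbb{N}_0$ with root $0$. The bottom of the $\ell^2$-spectrum of $-\Delta$ is $\lambda_0(\mathbb{T}_{d+1})=(\sqrt d-1)^2$. Functions and form. $C(X)$ is the set of real functions on $X$; for $\Omega\subseteq X$, $C_c(\Omega)$ is the set of finitely supported functions on $X$ vanishing outside $\Omega$. $-\Delta f(x)=\frac{1}{m(x)}\sum_{y}b(x,y)(f(x)-f(y))$ and $E(\varphi)=\frac12\sum_{x,y\in X}b(x,y)(\varphi(x)-\varphi(y))^2$ for $\varphi\in C_c(X)$. For a weight $w$ write $\|\varphi\|_w^2=\sum_x w(x)\varphi(x)^2m(x)$; for $\varphi\in C_c(\Omega)$ only the values of $w$ on $\Omega$ matter. A function $u\in C(X)$ is $(-\Delta-w)$-superharmonic on $\Omega$ if $-\Delta u-wu\ge 0$ on $\Omega$. Optimality. A function $w\ge 0$, not identically zero, is a Hardy weight of $-\Delta$ on $\Omega$ if $E(\varphi)\ge\|\varphi\|_w^2$ for all $\varphi\in C_c(\Omega)$. A Hardy weight $w$ on $\Omega$ is optimal if: (1) $-\Delta-w$ is critical on $\Omega$: there exists a unique (up to multiplication by a constant) positive $(-\Delta-w)$-superharmonic function $u$ on $\Omega$,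 called the Agmon ground state; (2) $-\Delta-w$ is null-critical on $\Omega$ with respect to $w$: the Agmon ground state $u$ is not in $\ell^2(\Omega,wm)$, i.e. $\sum_{x\in\Omega}u(x)^2w(x)m(x)=\infty$; (3) $w$ is optimal near infinity: for all $\lambda>0$ and all finite $K\subseteq\Omega$, the inequality $E(\varphi)\ge\|\varphi\|^2_{(1+\lambda)w}$ does not hold for all $\varphi\in C_c(\Omega\setminus K)$.
   Formalization: Uniqueness of the Agmon ground state is up to a constant on each connected component of Ω: for d≥2, rescaling √r·d^(-r/2) on a single branch refutes uniqueness up to one constant. Positive means u>0 on Ω and u≥0 at the root o. *)

theory Defs
  imports "HOL-Analysis.Analysis"
begin

text \<open>
  A weighted graph is given by a vertex set \<open>X\<close>, a symmetric edge weight \<open>b\<close> and a vertex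
  measure \<open>m\<close>. An element of \<open>C(X)\<close> is a function on the whole type of which only the values
  on \<open>X\<close> are ever used. All sums over \<open>y\<close> or \<open>(x, y)\<close> below are infinite sums in form only:
  on a locally finite graph, and for finitely supported functions in the case of the energy,
  all but finitely many terms vanish.
\<close>

definition neg_laplacian ::
  "'v set \<Rightarrow> ('v \<Rightarrow> 'v \<Rightarrow> real) \<Rightarrow> ('v \<Rightarrow> real) \<Rightarrow> ('v \<Rightarrow> real) \<Rightarrow> 'v \<Rightarrow> real" where
  "neg_laplacian X b m f x = 1 / m x * (\<Sum>\<^sub>\<infinity>y\<in>X. b x y * (f x - f y))"

definition energy :: "'v set \<Rightarrow> ('v \<Rightarrow> 'v \<Rightarrow> real) \<Rightarrow> ('v \<Rightarrow> real) \<Rightarrow> real" where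
  "energy X b \<phi> = 1 / 2 * (\<Sum>\<^sub>\<infinity>(x, y)\<in>X \<times> X. b x y * (\<phi> x - \<phi> y)\<^sup>2)"

definition weighted_norm_sq ::
  "'v set \<Rightarrow> ('v \<Rightarrow> real) \<Rightarrow> ('v \<Rightarrow> real) \<Rightarrow> ('v \<Rightarrow> real) \<Rightarrow> real" where
  "weighted_norm_sq X m w \<phi> = (\<Sum>\<^sub>\<infinity>x\<in>X. w x * (\<phi> x)\<^sup>2 * m x)"

definition Cc :: "'v set \<Rightarrow> ('v \<Rightarrow> real) set" where
  "Cc \<Omega> = {\<phi>. finite {x. \<phi> x \<noteq> 0} \<and> (\<forall>x. x \<notin> \<Omega> \<longrightarrow> \<phi> x = 0)}"

definition adjacency :: "'v set \<Rightarrow> ('v \<Rightarrow> 'v \<Rightarrow> real) \<Rightarrow> ('v \<times> 'v) set" where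
  "adjacency \<Omega> b = {(x, y). x \<in> \<Omega> \<and> y \<in> \<Omega> \<and> b x y \<noteq> 0}"

definition graph_dist :: "'v set \<Rightarrow> ('v \<Rightarrow> 'v \<Rightarrow> real) \<Rightarrow> 'v \<Rightarrow> 'v \<Rightarrow> nat" where
  "graph_dist X b x y = (LEAST n. (x, y) \<in> adjacency X b ^^ n)"

definition components :: "'v set \<Rightarrow> ('v \<Rightarrow> 'v \<Rightarrow> real) \<Rightarrow> 'v set set" where
  "components \<Omega> b = {{y. (x, y) \<in> (adjacency \<Omega> b)\<^sup>*} | x. x \<in> \<Omega>}"

definition closed_nbhd :: "'v set \<Rightarrow> ('v \<Rightarrow> 'v \<Rightarrow> real) \<Rightarrow> 'v set \<Rightarrow> 'v set" where
  "closed_nbhd X b C = C \<union> {y \<in> X. \<exists>x\<in>C. b x y \<noteq> 0}"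


text \<open>
  Real \<open>\<ell>\<^sup>2(X, m)\<close>; functions are normalised to be zero off \<open>X\<close>, so that bijectivity of an
  operator on this set is meaningful. The spectrum below is meant for graphs on which the
  Laplacian is bounded on \<open>\<ell>\<^sup>2\<close> (such as graphs of bounded degree with unit weights). There it
  is self-adjoint, so its spectrum is real and real scalars suffice.
\<close>

definition ell2 :: "'v set \<Rightarrow> ('v \<Rightarrow> real) \<Rightarrow> ('v \<Rightarrow> real) set" where
  "ell2 X m = {f. (\<forall>x. x \<notin> X \<longrightarrow> f x = 0) \<and> (\<lambda>x. (f x)\<^sup>2 * m x) summable_on X}"

definition shifted_laplacian ::
  "'v set \<Rightarrow> ('v \<Rightarrow> 'v \<Rightarrow> real) \<Rightarrow> ('v \<Rightarrow> real) \<Rightarrow> real \<Rightarrow> ('v \<Rightarrow> real) \<Rightarrow> 'v \<Rightarrow> real" where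
  "shifted_laplacian X b m \<mu> f = (\<lambda>x. if x \<in> X then neg_laplacian X b m f x - \<mu> * f x else 0)"

definition laplacian_spectrum ::
  "'v set \<Rightarrow> ('v \<Rightarrow> 'v \<Rightarrow> real) \<Rightarrow> ('v \<Rightarrow> real) \<Rightarrow> real set" where
  "laplacian_spectrum X b m = {\<mu>. \<not> (
     bij_betw (shifted_laplacian X b m \<mu>) (ell2 X m) (ell2 X m) \<and>
     (\<exists>B. \<forall>f\<in>ell2 X m.
        weighted_norm_sq X m (\<lambda>_. 1) f
          \<le> B * weighted_norm_sq X m (\<lambda>_. 1) (shifted_laplacian X b m \<mu> f)))}"

definition spectral_bottom ::
  "'v set \<Rightarrow> ('v \<Rightarrow> 'v \<Rightarrow> real) \<Rightarrow> ('v \<Rightarrow> real) \<Rightarrow> real" where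
  "spectral_bottom X b m = Inf (laplacian_spectrum X b m)"


definition superharmonic_on ::
  "'v set \<Rightarrow> ('v \<Rightarrow> 'v \<Rightarrow> real) \<Rightarrow> ('v \<Rightarrow> real) \<Rightarrow> 'v set \<Rightarrow> ('v \<Rightarrow> real) \<Rightarrow> ('v \<Rightarrow> real) \<Rightarrow> bool" where
  "superharmonic_on X b m \<Omega> w u \<longleftrightarrow> (\<forall>x\<in>\<Omega>. neg_laplacian X b m u x - w x * u x \<ge> 0)"

text \<open>
  Positivity of \<open>u\<close> on \<open>\<Omega>\<close> is strict. Off \<open>\<Omega>\<close> only nonnegativity is asked: the value zero
  has to be allowed there (Dirichlet condition), and negative values have to be excluded,
  since otherwise lowering \<open>u\<close> off \<open>\<Omega>\<close> would always give further superharmonic functions.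
\<close>

definition positive_superharmonic ::
  "'v set \<Rightarrow> ('v \<Rightarrow> 'v \<Rightarrow> real) \<Rightarrow> ('v \<Rightarrow> real) \<Rightarrow> 'v set \<Rightarrow> ('v \<Rightarrow> real) \<Rightarrow> ('v \<Rightarrow> real) \<Rightarrow> bool" where
  "positive_superharmonic X b m \<Omega> w u \<longleftrightarrow>
     (\<forall>x\<in>\<Omega>. u x > 0) \<and> (\<forall>x\<in>X. u x \<ge> 0) \<and> superharmonic_on X b m \<Omega> w u"

text \<open>
  \<open>u\<close> is an Agmon ground state if it is the unique positive superharmonic function up to
  multiplication by a constant. The constant may depend on the connected component of \<open>\<Omega>\<close>:
  functions can be rescaled on each component separately when they vanish off \<open>\<Omega>\<close>, so for
  disconnected \<open>\<Omega>\<close> uniqueness up to one global constant cannot hold. For connected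
  \<open>\<Omega>\<close> this is uniqueness up to a constant. Values at the vertices of \<open>X\<close> adjacent
  to a component enter the condition of superharmonicity and are compared as well.
\<close>

definition agmon_ground_state ::
  "'v set \<Rightarrow> ('v \<Rightarrow> 'v \<Rightarrow> real) \<Rightarrow> ('v \<Rightarrow> real) \<Rightarrow> 'v set \<Rightarrow> ('v \<Rightarrow> real) \<Rightarrow> ('v \<Rightarrow> real) \<Rightarrow> bool" where
  "agmon_ground_state X b m \<Omega> w u \<longleftrightarrow>
     positive_superharmonic X b m \<Omega> w u \<and>
     (\<forall>v. positive_superharmonic X b m \<Omega> w v \<longrightarrow>
        (\<forall>C\<in>components \<Omega> b. \<exists>c. \<forall>x\<in>closed_nbhd X b C. v x = c * u x))"

definition critical ::
  "'v set \<Rightarrow> ('v \<Rightarrow> 'v \<Rightarrow> real) \<Rightarrow> ('v \<Rightarrow> real) \<Rightarrow> 'v set \<Rightarrow> ('v \<Rightarrow> real) \<Rightarrow> bool" where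
  "critical X b m \<Omega> w \<longleftrightarrow> (\<exists>u. agmon_ground_state X b m \<Omega> w u)"

definition null_critical ::
  "'v set \<Rightarrow> ('v \<Rightarrow> 'v \<Rightarrow> real) \<Rightarrow> ('v \<Rightarrow> real) \<Rightarrow> 'v set \<Rightarrow> ('v \<Rightarrow> real) \<Rightarrow> bool" where
  "null_critical X b m \<Omega> w \<longleftrightarrow>
     critical X b m \<Omega> w \<and>
     (\<forall>u. agmon_ground_state X b m \<Omega> w u \<longrightarrow> \<not> (\<lambda>x. (u x)\<^sup>2 * w x * m x) summable_on \<Omega>)"

definition optimal_near_infinity ::
  "'v set \<Rightarrow> ('v \<Rightarrow> 'v \<Rightarrow> real) \<Rightarrow> ('v \<Rightarrow> real) \<Rightarrow> 'v set \<Rightarrow> ('v \<Rightarrow> real) \<Rightarrow> bool" where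
  "optimal_near_infinity X b m \<Omega> w \<longleftrightarrow>
     (\<forall>\<epsilon>>0. \<forall>K. finite K \<and> K \<subseteq> \<Omega> \<longrightarrow>
        \<not> (\<forall>\<phi>\<in>Cc (\<Omega> - K). energy X b \<phi> \<ge> weighted_norm_sq X m (\<lambda>x. (1 + \<epsilon>) * w x) \<phi>))"

definition hardy_weight ::
  "'v set \<Rightarrow> ('v \<Rightarrow> 'v \<Rightarrow> real) \<Rightarrow> ('v \<Rightarrow> real) \<Rightarrow> 'v set \<Rightarrow> ('v \<Rightarrow> real) \<Rightarrow> bool" where
  "hardy_weight X b m \<Omega> w \<longleftrightarrow>
     (\<forall>x\<in>\<Omega>. w x \<ge> 0) \<and> (\<exists>x\<in>\<Omega>. w x \<noteq> 0) \<and>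
     (\<forall>\<phi>\<in>Cc \<Omega>. energy X b \<phi> \<ge> weighted_norm_sq X m w \<phi>)"

definition optimal_hardy_weight ::
  "'v set \<Rightarrow> ('v \<Rightarrow> 'v \<Rightarrow> real) \<Rightarrow> ('v \<Rightarrow> real) \<Rightarrow> 'v set \<Rightarrow> ('v \<Rightarrow> real) \<Rightarrow> bool" where
  "optimal_hardy_weight X b m \<Omega> w \<longleftrightarrow>
     hardy_weight X b m \<Omega> w \<and> critical X b m \<Omega> w \<and> null_critical X b m \<Omega> w \<and>
     optimal_near_infinity X b m \<Omega> w"


text \<open>
  The rooted tree \<open>T\<^bsub>d+1\<^esub>\<close>: vertices are the finite words over \<open>{0, \<dots>, d - 1}\<close>, the root is the
  empty word, and the children of \<open>x\<close> are the words \<open>a # x\<close>, so \<open>x\<close> is the parent of \<open>a # x\<close>.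
\<close>

definition tree :: "nat \<Rightarrow> nat list set" where
  "tree d = {x. set x \<subseteq> {..<d}}"

abbreviation tree_root :: "nat list" where
  "tree_root \<equiv> []"

definition tree_edge :: "nat list \<Rightarrow> nat list \<Rightarrow> real" where
  "tree_edge x y = (if (\<exists>a. y = a # x) \<or> (\<exists>a. x = a # y) then 1 else 0)"

definition tree_measure :: "nat list \<Rightarrow> real" where
  "tree_measure x = 1"

definition lambda0 :: "nat \<Rightarrow> real" where
  "lambda0 d = spectral_bottom (tree d) tree_edge tree_measure"

definition tree_radius :: "nat \<Rightarrow> nat list \<Rightarrow> nat" where
  "tree_radius d x = graph_dist (tree d) tree_edge tree_root x"

definition w0 :: "nat \<Rightarrow> nat \<Rightarrow> real" where
  "w0 d r = lambda0 d + sqrt (real d) * (2 - sqrt (1 - 1 / real r) - sqrt (1 + 1 / real r))"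

end

theory Submission
  imports Defs
begin

text \<open>
  The radial function \<open>u(r) = \<surd>r d\<^bsup>-r/2\<^esup>\<close> vanishes at the root and satisfies \<open>-\<Delta>u = w u\<close> off the root,
  with \<open>w\<close> the weight of the theorem once \<open>\<lambda>\<^sub>0 = (\<surd>d - 1)\<^sup>2\<close> is known. Hence the ground state transform
  \<open>E(u\<psi>) = \<parallel>u\<psi>\<parallel>\<^sub>w\<^sup>2 + \<Sum> u(x) u(y) (\<psi>(x) - \<psi>(y))\<^sup>2\<close>, the sum being over the edges. The edges between the
  spheres of radius \<open>r\<close> and \<open>r + 1\<close> have total weight about \<open>\<surd>d r\<close>, so the transformed graph behaves
  like a half-line with conductances \<open>r\<close>: it is recurrent, and piecewise linear functions of the
  harmonic number of \<open>r\<close> serve as test functions both for criticality and for optimality near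
  infinity. Null-criticality is the divergence of \<open>\<Sum> r w(r) \<ge> \<Sum> \<surd>d / (4 r)\<close>.

  For \<open>\<lambda>\<^sub>0\<close>, write \<open>-\<Delta> = d + 1 - B\<close>. A Schur test gives \<open>\<parallel>B\<parallel> \<le> 2 \<surd>d\<close>, so that \<open>c - B\<close> is inverted
  for \<open>c > 2 \<surd>d\<close> by a monotone iteration on nonnegative functions.
\<close>

subsection \<open>Summation over the tree\<close>

text \<open>The balls exhaust the tree. Sums over the tree are evaluated or bounded through finite
  sums over balls, where words can be split into first letter and parent.\<close>

definition tree_ball :: "nat \<Rightarrow> nat \<Rightarrow> nat list set" where
  "tree_ball d N = {x \<in> tree d. length x \<le> N}"

lemma in_tree_ball [simp]: "x \<in> tree_ball d N \<longleftrightarrow> x \<in> tree d \<and> length x \<le> N"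
  by (simp add: tree_ball_def)

lemma Nil_in_tree [simp]: "[] \<in> tree d"
  by (simp add: tree_def)

lemma Cons_in_tree [simp]: "a # x \<in> tree d \<longleftrightarrow> a < d \<and> x \<in> tree d"
  by (auto simp: tree_def)

lemma tl_in_tree: "x \<in> tree d \<Longrightarrow> tl x \<in> tree d"
  by (cases x) auto

lemma finite_tree_ball [simp]: "finite (tree_ball d N)"
  using finite_lists_length_le[of "{..<d}" N] by (simp add: tree_ball_def tree_def)

lemma tree_ball_Suc:
  "tree_ball d (Suc N) = insert [] ((\<lambda>(x, a). a # x) ` (tree_ball d N \<times> {..<d}))"
proof (intro equalityI subsetI)
  fix x assume "x \<in> tree_ball d (Suc N)"
  then show "x \<in> insert [] ((\<lambda>(x, a). a # x) ` (tree_ball d N \<times> {..<d}))"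
    by (cases x) auto
qed auto

text \<open>Every word other than the root is \<open>a # x\<close> for exactly one parent
  \<open>x\<close> and letter \<open>a\<close>. This serves as summation by parts: sums over edges,
  indexed by parent and letter, become sums over the child vertices.\<close>

lemma sum_tree_ball_Suc:
  "sum f (tree_ball d (Suc N)) = f [] + (\<Sum>x\<in>tree_ball d N. \<Sum>a<d. f (a # x))"
proof -
  have "sum f (tree_ball d (Suc N)) = f [] + sum f ((\<lambda>(x, a). a # x) ` (tree_ball d N \<times> {..<d}))"
    unfolding tree_ball_Suc by (rule sum.insert) auto
  also have "sum f ((\<lambda>(x, a). a # x) ` (tree_ball d N \<times> {..<d})) =
      (\<Sum>(x, a)\<in>tree_ball d N \<times> {..<d}. f (a # x))"
    by (subst sum.reindex) (auto simp: inj_on_def case_prod_unfold)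
  finally show ?thesis
    by (simp add: sum.cartesian_product)
qed

text \<open>The sphere of radius \<open>r\<close> has \<open>d ^ r\<close> vertices.
  \<open>F\<close> is general in the induction, since removing the first letter turns it into
  \<open>\<lambda>r. real d * F (Suc r)\<close>.\<close>

lemma sum_tree_ball_radial:
  fixes F :: "nat \<Rightarrow> real"
  shows "(\<Sum>x\<in>tree_ball d N. F (length x)) = (\<Sum>r\<le>N. real d ^ r * F r)"
proof (induction N arbitrary: F)
  case 0
  have "tree_ball d 0 = {[]}"
    by auto
  then show ?case by simp
next
  case (Suc N)
  have "(\<Sum>x\<in>tree_ball d (Suc N). F (length x)) =
      F 0 + (\<Sum>x\<in>tree_ball d N. real d * F (Suc (length x)))"
    by (simp add: sum_tree_ball_Suc)
  also have "\<dots> = F 0 + (\<Sum>r\<le>N. real d ^ r * (real d * F (Suc r)))"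
    using Suc.IH[of "\<lambda>r. real d * F (Suc r)"] by simp
  also have "\<dots> = (\<Sum>r\<le>Suc N. real d ^ r * F r)"
    by (simp add: sum.atMost_Suc_shift mult_ac del: sum.atMost_Suc)
  finally show ?case .
qed

lemma sum_tree_ball_extend:
  assumes "\<And>x. N < length x \<Longrightarrow> f x = 0" "N \<le> M"
  shows "sum f (tree_ball d M) = sum f (tree_ball d N)"
  using assms by (intro sum.mono_neutral_right) auto

lemma tree_summable_bounded:
  fixes f :: "nat list \<Rightarrow> real"
  assumes nonneg: "\<And>x. x \<in> tree d \<Longrightarrow> 0 \<le> f x"
    and bound: "\<And>N. sum f (tree_ball d N) \<le> M"
  shows "f summable_on tree d" "infsum f (tree d) \<le> M"
proof -
  have fin: "sum f F \<le> M" if "finite F" "F \<subseteq> tree d" for F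
  proof -
    \<comment> \<open>For empty \<open>F\<close> the maximum is unspecified, but the inclusion is
      then vacuous.\<close>
    have "F \<subseteq> tree_ball d (Max (length ` F))"
      using that by auto
    then have "sum f F \<le> sum f (tree_ball d (Max (length ` F)))"
      using nonneg by (intro sum_mono2) auto
    with bound show ?thesis by (meson order_trans)
  qed
  show sf: "f summable_on tree d"
    using fin by (intro nonneg_bdd_above_summable_on nonneg bdd_aboveI[of _ M]) auto
  show "infsum f (tree d) \<le> M"
    by (rule infsum_le_finite_sums[OF sf fin])
qed

lemma sum_tree_ball_le_infsum:
  fixes f :: "nat list \<Rightarrow> real"
  assumes "f summable_on tree d" "\<And>x. x \<in> tree d \<Longrightarrow> 0 \<le> f x"
  shows "sum f (tree_ball d N) \<le> infsum f (tree d)"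
  using assms by (intro finite_sum_le_infsum) auto


subsection \<open>Laplacian, energy and distance on the tree\<close>

text \<open>Since \<open>tl [] = []\<close>, the term for the missing parent of the root vanishes.\<close>

definition tree_laplacian :: "nat \<Rightarrow> (nat list \<Rightarrow> real) \<Rightarrow> nat list \<Rightarrow> real" where
  "tree_laplacian d f x = f x - f (tl x) + (\<Sum>a<d. f x - f (a # x))"

lemma neg_laplacian_tree:
  assumes "x \<in> tree d"
  shows "neg_laplacian (tree d) tree_edge tree_measure f x = tree_laplacian d f x"
proof -
  let ?g = "\<lambda>y. tree_edge x y * (f x - f y)"
  let ?C = "(\<lambda>a. a # x) ` {..<d}"
  have tlx: "tl x \<notin> ?C" by (cases x) auto
  have "infsum ?g (tree d) = infsum ?g (insert (tl x) ?C)"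
  proof (rule infsum_cong_neutral)
    fix y assume "y \<in> insert (tl x) ?C - tree d"
    with assms show "?g y = 0" by (auto dest: tl_in_tree)
  next
    fix y assume "y \<in> tree d - insert (tl x) ?C"
    then show "?g y = 0" by (auto simp: tree_edge_def)
  qed auto
  also have "\<dots> = ?g (tl x) + sum ?g ?C"
    using tlx by simp
  also have "?g (tl x) = f x - f (tl x)"
    by (cases x) (auto simp: tree_edge_def)
  also have "sum ?g ?C = (\<Sum>a<d. f x - f (a # x))"
    by (subst sum.reindex) (auto simp: inj_on_def tree_edge_def)
  finally show ?thesis
    by (simp add: neg_laplacian_def tree_measure_def tree_laplacian_def)
qed

text \<open>Ordered pairs count each edge twice, child first in \<open>?A\<close> and parent first
  in \<open>?B\<close>, which cancels the factor 1/2. Parents up to length \<open>N\<close> suffice: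
  deeper edges join two zeros of \<open>\<phi>\<close>.\<close>

lemma energy_tree:
  assumes supp: "\<And>x. N < length x \<Longrightarrow> \<phi> x = 0"
  shows "energy (tree d) tree_edge \<phi> = (\<Sum>y\<in>tree_ball d N. \<Sum>a<d. (\<phi> (a # y) - \<phi> y)\<^sup>2)"
proof -
  let ?g = "\<lambda>(x, y). tree_edge x y * (\<phi> x - \<phi> y)\<^sup>2"
  let ?D = "tree_ball d N \<times> {..<d}"
  let ?A = "(\<lambda>(y, a). (a # y, y)) ` ?D" and ?B = "(\<lambda>(y, a). (y, a # y)) ` ?D"
  have "infsum ?g (tree d \<times> tree d) = infsum ?g (?A \<union> ?B)"
  proof (rule infsum_cong_neutral)
    fix p assume p: "p \<in> tree d \<times> tree d - (?A \<union> ?B)"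
    show "?g p = 0"
    proof (rule ccontr)
      assume nz: "?g p \<noteq> 0"
      obtain x y where xy: "p = (x, y)" by force
      have lower: "length z \<le> N" if "\<phi> (a # z) \<noteq> \<phi> z" for a z
        using that supp[of z] supp[of "a # z"] by (cases "N < length z") auto
      from nz xy consider a where "y = a # x" | a where "x = a # y"
        by (auto simp: tree_edge_def split: if_splits)
      then show False
      proof cases
        case 1
        with nz xy p lower[of a x] show False
          by (force simp: image_iff)
      next
        case 2
        with nz xy p lower[of a y] show False
          by (force simp: image_iff)
      qed
    qed
  qed auto
  also have "\<dots> = sum ?g ?A + sum ?g ?B"
    by (subst infsum_finite) (auto intro!: sum.union_disjoint)
  also have "sum ?g ?A = (\<Sum>(y, a)\<in>?D. (\<phi> (a # y) - \<phi> y)\<^sup>2)"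
    by (subst sum.reindex) (auto simp: inj_on_def tree_edge_def intro!: sum.cong)
  also have "sum ?g ?B = (\<Sum>(y, a)\<in>?D. (\<phi> (a # y) - \<phi> y)\<^sup>2)"
    by (subst sum.reindex) (auto simp: inj_on_def tree_edge_def power2_commute intro!: sum.cong)
  finally show ?thesis
    by (simp add: energy_def sum.cartesian_product)
qed

lemma weighted_norm_sq_tree:
  assumes "\<And>x. N < length x \<Longrightarrow> \<phi> x = 0"
  shows "weighted_norm_sq (tree d) tree_measure w \<phi> = (\<Sum>x\<in>tree_ball d N. w x * (\<phi> x)\<^sup>2)"
proof -
  have "weighted_norm_sq (tree d) tree_measure w \<phi> = infsum (\<lambda>x. w x * (\<phi> x)\<^sup>2) (tree_ball d N)"
    unfolding weighted_norm_sq_def tree_measure_def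
    using assms by (intro infsum_cong_neutral) auto
  then show ?thesis by simp
qed

text \<open>Prepending the letters one by one walks from the root to \<open>x\<close>; conversely a
  step along an edge changes the length by exactly one, so no shorter walk exists.\<close>

lemma tree_radius_eq_length:
  assumes "x \<in> tree d"
  shows "tree_radius d x = length x"
  unfolding tree_radius_def graph_dist_def
proof (rule Least_equality)
  show "([], x) \<in> adjacency (tree d) tree_edge ^^ length x"
    using assms
  proof (induction x)
    case (Cons a x)
    then have "(x, a # x) \<in> adjacency (tree d) tree_edge"
      by (auto simp: adjacency_def tree_edge_def)
    with Cons show ?case
      by (auto intro: relcompI)
  qed simp
next
  fix n assume "([], x) \<in> adjacency (tree d) tree_edge ^^ n"
  then show "length x \<le> n"
  proof (induction n arbitrary: x)
    case (Suc n)
    then obtain y where "([], y) \<in> adjacency (tree d) tree_edge ^^ n" 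
      "(y, x) \<in> adjacency (tree d) tree_edge"
      by auto
    with Suc.IH[of y] show ?case
      by (auto simp: adjacency_def tree_edge_def split: if_splits)
  qed simp
qed

text \<open>Letters are prepended, so the last letter names the child of the root below which a word
  lies. Edges that avoid the root preserve it, hence a component stays in one branch and its
  neighbourhood adds at most the root.\<close>

lemma closed_nbhd_component_subset:
  assumes "C \<in> components (tree d - {[]}) tree_edge"
  obtains a where "a < d" "closed_nbhd (tree d) tree_edge C \<subseteq> {x \<in> tree d. x = [] \<or> last x = a}"
proof -
  let ?adj = "adjacency (tree d - {[]}) tree_edge"
  obtain x where x: "x \<in> tree d" "x \<noteq> []" and C: "C = {y. (x, y) \<in> ?adj\<^sup>*}"
    using assms by (auto simp: components_def)
  have *: "y \<in> tree d \<and> y \<noteq> [] \<and> last y = last x" if "y \<in> C" for y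
  proof -
    have "(x, y) \<in> ?adj\<^sup>*" using that by (simp add: C)
    then show ?thesis
    proof (induction rule: rtrancl_induct)
      case (step y z)
      then show ?case
        by (auto simp: adjacency_def tree_edge_def split: if_splits)
    qed (use x in auto)
  qed
  have "last x < d"
    using last_in_set[of x] x by (auto simp: tree_def subset_iff simp del: last_in_set)
  moreover have "closed_nbhd (tree d) tree_edge C \<subseteq> {y \<in> tree d. y = [] \<or> last y = last x}"
  proof
    fix y assume "y \<in> closed_nbhd (tree d) tree_edge C"
    then have "y \<in> C \<or> y \<in> tree d \<and> (\<exists>z\<in>C. tree_edge z y \<noteq> 0)"
      by (simp add: closed_nbhd_def)
    then show "y \<in> {y \<in> tree d. y = [] \<or> last y = last x}"
    proof (elim disjE conjE bexE)
      assume "y \<in> C"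
      with * show ?thesis by blast
    next
      fix z assume "y \<in> tree d" "z \<in> C" "tree_edge z y \<noteq> 0"
      with *[of z] show ?thesis
        by (auto simp: tree_edge_def split: if_splits)
    qed
  qed
  ultimately show thesis by (rule that)
qed

subsection \<open>The ground state transform\<close>

text \<open>Edgewise this is the identity \<open>(p - q)^2 = p^2 / v * (v - w) + q^2 / w * (w - v) +
  v * w * (p / v - q / w)^2\<close>; collecting the first two terms at each vertex produces the
  Laplacian of \<open>v\<close>.\<close>

lemma ground_state_transform:
  fixes v \<phi> :: "nat list \<Rightarrow> real"
  assumes pos: "\<And>x. x \<in> tree d \<Longrightarrow> x \<noteq> [] \<Longrightarrow> 0 < v x"
    and supp: "\<And>x. N < length x \<Longrightarrow> \<phi> x = 0" and root: "\<phi> [] = 0"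
  shows "(\<Sum>y\<in>tree_ball d N. \<Sum>a<d. (\<phi> (a # y) - \<phi> y)\<^sup>2) =
    (\<Sum>x\<in>tree_ball d N. (\<phi> x)\<^sup>2 / v x * tree_laplacian d v x) +
    (\<Sum>y\<in>tree_ball d N. \<Sum>a<d. v (a # y) * v y * (\<phi> (a # y) / v (a # y) - \<phi> y / v y)\<^sup>2)"
proof -
  \<comment> \<open>The share of the parent edge in the Laplacian term at \<open>x\<close>. Summed
    over edges it is attached to the child, and \<open>sum_tree_ball_Suc\<close> moves it to the
    vertices.\<close>
  define G where "G = (\<lambda>x. (\<phi> x)\<^sup>2 / v x * (v x - v (tl x)))"
  have "(\<phi> (a # y) - \<phi> y)\<^sup>2 = G (a # y) + (\<phi> y)\<^sup>2 / v y * (v y - v (a # y)) +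
      v (a # y) * v y * (\<phi> (a # y) / v (a # y) - \<phi> y / v y)\<^sup>2"
    if "y \<in> tree d" "a < d" for y a
  proof (cases "y = []")
    \<comment> \<open>Nothing is known about \<open>v []\<close>, but \<open>\<phi> [] = 0\<close>
      makes both quotients by it vanish, and the identity holds for any value of
      \<open>v []\<close>.\<close>
    case True
    have "v [a] > 0" using pos that by simp
    with True root show ?thesis
      by (simp add: G_def field_simps power2_eq_square)
  next
    case False
    then have "v (a # y) > 0" "v y > 0" using pos that by auto
    then show ?thesis
      by (simp add: G_def field_simps power2_eq_square)
  qed
  then have "(\<Sum>y\<in>tree_ball d N. \<Sum>a<d. (\<phi> (a # y) - \<phi> y)\<^sup>2) =
     (\<Sum>y\<in>tree_ball d N. \<Sum>a<d. G (a # y) + (\<phi> y)\<^sup>2 / v y * (v y - v (a # y)) +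
        v (a # y) * v y * (\<phi> (a # y) / v (a # y) - \<phi> y / v y)\<^sup>2)"
    by (intro sum.cong refl) auto
  also have "\<dots> = (\<Sum>y\<in>tree_ball d N. \<Sum>a<d. G (a # y)) +
      (\<Sum>y\<in>tree_ball d N. (\<phi> y)\<^sup>2 / v y * (\<Sum>a<d. v y - v (a # y))) +
      (\<Sum>y\<in>tree_ball d N. \<Sum>a<d. v (a # y) * v y * (\<phi> (a # y) / v (a # y) - \<phi> y / v y)\<^sup>2)"
    by (simp only: sum.distrib sum_distrib_left)
  also have "(\<Sum>y\<in>tree_ball d N. \<Sum>a<d. G (a # y)) = sum G (tree_ball d (Suc N))"
    using root by (simp add: sum_tree_ball_Suc G_def)
  also have "\<dots> = sum G (tree_ball d N)"
    using supp by (intro sum_tree_ball_extend) (auto simp: G_def)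
  finally show ?thesis
    by (simp add: G_def tree_laplacian_def distrib_left sum.distrib)
qed

lemma Cc_tree_bounded:
  assumes "\<phi> \<in> Cc (tree d - {[]})"
  obtains N where "\<And>x. N < length x \<Longrightarrow> \<phi> x = 0" "\<phi> [] = 0"
proof -
  have fin: "finite {x. \<phi> x \<noteq> 0}" using assms by (simp add: Cc_def)
  have "\<phi> x = 0" if "Max (length ` {x. \<phi> x \<noteq> 0}) < length x" for x
    using fin that by (meson Max_ge finite_imageI imageI mem_Collect_eq not_le)
  moreover have "\<phi> [] = 0" using assms by (simp add: Cc_def)
  ultimately show thesis by (rule that)
qed

subsection \<open>The Agmon ground state\<close>

definition ground_profile :: "nat \<Rightarrow> nat \<Rightarrow> real" where
  "ground_profile d r = sqrt (real r) / sqrt (real d) ^ r"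

text \<open>The weight \<open>w0\<close> with the value of the spectral bottom inserted. The Hardy
  theory is developed for this explicit function, and \<open>lambda0_eq\<close> identifies the two
  at the end.\<close>

definition hardy_profile :: "nat \<Rightarrow> nat \<Rightarrow> real" where
  "hardy_profile d r = (sqrt (real d) - 1)\<^sup>2 +
     sqrt (real d) * (2 - sqrt (1 - 1 / real r) - sqrt (1 + 1 / real r))"

lemma ground_profile_0 [simp]: "ground_profile d 0 = 0"
  by (simp add: ground_profile_def)

lemma ground_profile_pos: "d \<ge> 1 \<Longrightarrow> r > 0 \<Longrightarrow> 0 < ground_profile d r"
  by (simp add: ground_profile_def)

text \<open>With \<open>s = sqrt d\<close> and \<open>u\<close> the profile,
  \<open>u (r - 1) = s * sqrt (1 - 1/r) * u r\<close> and
  \<open>d * u (r + 1) = s * sqrt (1 + 1/r) * u r\<close>. The remaining constant is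
  \<open>d + 1 = (s - 1)^2 + 2 * s\<close>.\<close>

lemma ground_profile_eq:
  assumes "d \<ge> 1" "r \<ge> 1"
  shows "real (Suc d) * ground_profile d r - ground_profile d (r - 1) -
    real d * ground_profile d (Suc r) = hardy_profile d r * ground_profile d r"
proof -
  define s where "s = sqrt (real d)"
  have s: "s > 0" "real d = s\<^sup>2" using assms by (auto simp: s_def)
  have "real (r - 1) = real r * (1 - 1 / real r)" "1 + real r = real r * (1 + 1 / real r)"
    using assms by (auto simp: field_simps of_nat_diff)
  then have roots: "sqrt (real (r - 1)) = sqrt (real r) * sqrt (1 - 1 / real r)"
    "sqrt (1 + real r) = sqrt (real r) * sqrt (1 + 1 / real r)"
    by (simp_all only: real_sqrt_mult)
  have "s ^ r = s * s ^ (r - 1)"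
    using assms by (simp flip: power_Suc)
  then show ?thesis
    unfolding ground_profile_def hardy_profile_def s_def[symmetric] of_nat_Suc roots s(2)
    using s(1) by (simp add: field_simps power2_eq_square)
qed

text \<open>For \<open>t = 1/r\<close> the square of \<open>sqrt (1 - t) + sqrt (1 + t)\<close> is
  \<open>2 + 2 * sqrt (1 - t^2)\<close>, at most \<open>4 - t^2\<close> and hence at most
  \<open>(2 - t^2 / 4)^2\<close>. The nonnegative constant \<open>(sqrt d - 1)^2\<close> is dropped,
  so the bound also covers \<open>d = 1\<close>, where it vanishes.\<close>

lemma hardy_profile_ge:
  assumes "r \<ge> 1"
  shows "sqrt (real d) / (4 * (real r)\<^sup>2) \<le> hardy_profile d r"
proof -
  define t where "t = 1 / real r"
  have t: "0 \<le> t" "t \<le> 1" using assms by (auto simp: t_def)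
  have t2: "t\<^sup>2 \<le> 1" using t by (simp add: abs_square_le_1)
  have "sqrt (1 - t\<^sup>2) \<le> sqrt ((1 - t\<^sup>2 / 2)\<^sup>2)"
    by (rule real_sqrt_le_mono) (simp add: power2_diff)
  then have "sqrt (1 - t\<^sup>2) \<le> 1 - t\<^sup>2 / 2"
    using t2 by simp
  moreover have "sqrt (1 - t) * sqrt (1 + t) = sqrt (1 - t\<^sup>2)"
    by (simp add: algebra_simps power2_eq_square flip: real_sqrt_mult)
  ultimately have "(sqrt (1 - t) + sqrt (1 + t))\<^sup>2 \<le> 4 - t\<^sup>2"
    using t by (simp add: power2_sum)
  also have "\<dots> \<le> (2 - t\<^sup>2 / 4)\<^sup>2"
    by (simp add: power2_diff)
  finally have "sqrt (1 - t) + sqrt (1 + t) \<le> 2 - t\<^sup>2 / 4"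
    by (rule power2_le_imp_le) (use t2 in simp)
  then have "sqrt d * (t\<^sup>2 / 4) \<le> sqrt d * (2 - sqrt (1 - t) - sqrt (1 + t))"
    by (intro mult_left_mono) auto
  also have "\<dots> \<le> hardy_profile d r"
    by (simp add: hardy_profile_def t_def)
  finally show ?thesis
    by (simp add: t_def power_divide)
qed

lemma hardy_profile_pos: "d \<ge> 1 \<Longrightarrow> r \<ge> 1 \<Longrightarrow> 0 < hardy_profile d r"
  by (rule less_le_trans[OF _ hardy_profile_ge]) auto

lemma tree_laplacian_ground_profile:
  assumes "d \<ge> 1" "x \<noteq> []"
  shows "tree_laplacian d (\<lambda>x. ground_profile d (length x)) x =
    hardy_profile d (length x) * ground_profile d (length x)"
  using assms ground_profile_eq[of d "length x"]
  by (simp add: tree_laplacian_def Suc_le_eq algebra_simps)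

text \<open>The transform applied to the ground state itself. Its nonnegative remainder gives the
  Hardy inequality, and it is explicit enough to be estimated along test functions.\<close>

lemma hardy_identity:
  assumes d: "d \<ge> 1" and supp: "\<And>x. N < length x \<Longrightarrow> \<phi> x = 0" and root: "\<phi> [] = 0"
  shows "energy (tree d) tree_edge \<phi> =
    weighted_norm_sq (tree d) tree_measure (\<lambda>x. hardy_profile d (length x)) \<phi> +
    (\<Sum>y\<in>tree_ball d N. \<Sum>a<d. ground_profile d (Suc (length y)) * ground_profile d (length y) *
       (\<phi> (a # y) / ground_profile d (Suc (length y)) - \<phi> y / ground_profile d (length y))\<^sup>2)"
proof -
  have "(\<phi> x)\<^sup>2 / ground_profile d (length x) *
      tree_laplacian d (\<lambda>x. ground_profile d (length x)) x = hardy_profile d (length x) * (\<phi> x)\<^sup>2" for x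
  proof (cases "x = []")
    case False
    then show ?thesis
      using ground_profile_pos[OF d, of "length x"] tree_laplacian_ground_profile[OF d False] by (simp add: power2_eq_square)
  qed (simp add: root)
  then show ?thesis
    using ground_state_transform[of d "\<lambda>x. ground_profile d (length x)" N \<phi>] d supp root
    by (simp add: energy_tree[OF supp] weighted_norm_sq_tree[OF supp] ground_profile_pos)
qed

lemma hardy_inequality:
  assumes d: "d \<ge> 1" and \<phi>: "\<phi> \<in> Cc (tree d - {[]})"
  shows "weighted_norm_sq (tree d) tree_measure (\<lambda>x. hardy_profile d (length x)) \<phi>
    \<le> energy (tree d) tree_edge \<phi>"
proof -
  obtain N where supp: "\<And>x. N < length x \<Longrightarrow> \<phi> x = 0" and root: "\<phi> [] = 0"
    using Cc_tree_bounded[OF \<phi>] by blast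
  show ?thesis
    using d by (subst hardy_identity[where N = N]) (auto simp: supp root ground_profile_def intro!: sum_nonneg mult_nonneg_nonneg)
qed

subsection \<open>Test functions\<close>

text \<open>The edges between radii \<open>r\<close> and \<open>r + 1\<close> act like a conductance
  proportional to \<open>r\<close>, hence a resistance of order \<open>1/r\<close>. The harmonic
  number is therefore the natural coordinate for cut-offs of the ground state.\<close>

definition test_function :: "nat \<Rightarrow> (real \<Rightarrow> real) \<Rightarrow> nat list \<Rightarrow> real" where
  "test_function d g x =
     (if x \<in> tree d then ground_profile d (length x) * g (harm (length x)) else 0)"

lemma harm_eventually_ge:
  obtains N where "\<And>r. N \<le> r \<Longrightarrow> M \<le> (harm r :: real)"
  using harm_at_top by (auto simp: filterlim_at_top eventually_at_top_linorder)

lemma sum_harm_increments_le: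
  assumes "0 \<le> M"
  shows "(\<Sum>r<n. if harm r < M then 1 / real (Suc r) else 0) \<le> M + 1"
proof -
  \<comment> \<open>Below level \<open>M\<close> the increments telescope to \<open>harm n\<close>.
    The last one counted starts below \<open>M\<close> and has size at most 1, so the sum never
    passes \<open>M + 1\<close>; the minimum carries both facts through the induction.\<close>
  have "(\<Sum>r<n. if harm r < M then 1 / real (Suc r) else 0) \<le> min (M + 1) (harm n)"
  proof (induction n)
    case 0
    with assms show ?case by (simp add: harm_expand)
  next
    case (Suc n)
    have "0 \<le> 1 / real (Suc n)" "1 / real (Suc n) \<le> 1" by simp_all
    moreover have "harm (Suc n) = harm n + 1 / real (Suc n)"
      by (simp add: harm_Suc inverse_eq_divide)
    ultimately show ?case
      using Suc by (cases "harm n < M") (simp_all only: sum.lessThan_Suc min.bounded_iff if_True if_False, linarith+)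
  qed
  then show ?thesis by simp
qed

text \<open>The remainder reduces to a sum over radii with edge weight at most
  \<open>sqrt d * (r + 1)\<close> and squared increments at most \<open>1 / (r + 1)^2\<close>. Only
  radii below level \<open>M\<close> contribute, so it grows just linearly in
  \<open>M\<close>.\<close>

lemma test_function_energy:
  assumes d: "d \<ge> 1" and M: "0 \<le> M"
    and lip: "\<And>s t. \<bar>g s - g t\<bar> \<le> \<bar>s - t\<bar>" and van: "\<And>t. M \<le> t \<Longrightarrow> g t = 0"
  shows "energy (tree d) tree_edge (test_function d g) \<le>
    weighted_norm_sq (tree d) tree_measure (\<lambda>x. hardy_profile d (length x)) (test_function d g) +
    sqrt (real d) * (M + 1)"
proof -
  obtain N where N: "\<And>r. N \<le> r \<Longrightarrow> M \<le> harm r"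
    using harm_eventually_ge by blast
  define u where "u = ground_profile d"
  have u_pos: "0 < u r" if "0 < r" for r
    using that d by (simp add: u_def ground_profile_pos)
  have supp: "test_function d g x = 0" if "N < length x" for x
    using that N[of "length x"] by (simp add: test_function_def van)
  \<comment> \<open>There are \<open>d ^ (r + 1)\<close> edges at this level; against
    \<open>u (Suc r) * u r\<close> the powers of \<open>d\<close> leave
    \<open>sqrt d * sqrt (r * (r + 1))\<close>.\<close>
  have weight: "real d ^ r * (real d * (u (Suc r) * u r)) \<le> sqrt (real d) * real (Suc r)" for r
  proof -
    define s where "s = sqrt (real d)"
    have s: "s > 0" "real d = s\<^sup>2" using d by (auto simp: s_def)
    have "sqrt (real (Suc r)) * sqrt (real r) \<le> sqrt (real (Suc r)) * sqrt (real (Suc r))"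
      by (intro mult_left_mono) auto
    then have "sqrt (1 + real r) * sqrt (real r) \<le> 1 + real r"
      by simp
    moreover have "real d ^ r * (real d * (u (Suc r) * u r)) = s * (sqrt (1 + real r) * sqrt (real r))"
      unfolding u_def ground_profile_def s_def[symmetric] s(2)
      using s(1) by (simp add: field_simps power2_eq_square power_mult_distrib)
    ultimately show ?thesis
      using s(1) by (simp flip: s_def)
  qed
  have incr: "real (Suc r) * (g (harm (Suc r)) - g (harm r))\<^sup>2
      \<le> (if harm r < M then 1 / real (Suc r) else 0)" for r
  proof (cases "harm r < M")
    case True
    have "\<bar>g (harm (Suc r)) - g (harm r)\<bar> \<le> 1 / real (Suc r)"
      using lip[of "harm (Suc r)" "harm r"] by (simp add: harm_Suc inverse_eq_divide)
    then have "(g (harm (Suc r)) - g (harm r))\<^sup>2 \<le> (1 / real (Suc r))\<^sup>2"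
      by (rule abs_le_square_iff[THEN iffD1, OF order_trans]) simp
    then have "real (Suc r) * (g (harm (Suc r)) - g (harm r))\<^sup>2 \<le> real (Suc r) * (1 / real (Suc r))\<^sup>2"
      by (intro mult_left_mono) auto
    with True show ?thesis by (simp add: power2_eq_square)
  next
    case False
    moreover have "harm r \<le> (harm (Suc r) :: real)" by (intro harm_mono) simp
    ultimately show ?thesis by (simp add: van)
  qed
  have "(\<Sum>y\<in>tree_ball d N. \<Sum>a<d. u (Suc (length y)) * u (length y) *
       (test_function d g (a # y) / u (Suc (length y)) - test_function d g y / u (length y))\<^sup>2)
    = (\<Sum>y\<in>tree_ball d N. real d * (u (Suc (length y)) * u (length y) *
       (g (harm (Suc (length y))) - g (harm (length y)))\<^sup>2))"
  proof (intro sum.cong refl)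
    fix y assume y: "y \<in> tree_ball d N"
    have "u (Suc (length y)) * u (length y) *
        (test_function d g (a # y) / u (Suc (length y)) - test_function d g y / u (length y))\<^sup>2 =
        u (Suc (length y)) * u (length y) * (g (harm (Suc (length y))) - g (harm (length y)))\<^sup>2"
      if "a < d" for a
    proof (cases "y = []")
      \<comment> \<open>Edges at the root carry the weight factor \<open>u 0 = 0\<close>, so
        \<open>g\<close> may take any value at 0.\<close>
      case True
      then show ?thesis by (simp add: u_def)
    next
      case False
      then have "u (length y) > 0" "u (Suc (length y)) > 0" by (simp_all add: u_pos)
      with y that show ?thesis by (simp add: test_function_def flip: u_def)
    qed
    then have "(\<Sum>a<d. u (Suc (length y)) * u (length y) *
        (test_function d g (a # y) / u (Suc (length y)) - test_function d g y / u (length y))\<^sup>2) =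
        (\<Sum>a<d. u (Suc (length y)) * u (length y) *
          (g (harm (Suc (length y))) - g (harm (length y)))\<^sup>2)"
      by (intro sum.cong refl) (simp only: lessThan_iff)
    then show "(\<Sum>a<d. u (Suc (length y)) * u (length y) *
        (test_function d g (a # y) / u (Suc (length y)) - test_function d g y / u (length y))\<^sup>2) =
        real d * (u (Suc (length y)) * u (length y) *
          (g (harm (Suc (length y))) - g (harm (length y)))\<^sup>2)"
      by simp
  qed
  also have "\<dots> = (\<Sum>r\<le>N. real d ^ r * (real d * (u (Suc r) * u r * (g (harm (Suc r)) - g (harm r))\<^sup>2)))"
    by (rule sum_tree_ball_radial)
  also have "\<dots> \<le> (\<Sum>r\<le>N. sqrt (real d) * (if harm r < M then 1 / real (Suc r) else 0))"
  proof (rule sum_mono)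
    fix r
    have "real d ^ r * (real d * (u (Suc r) * u r * (g (harm (Suc r)) - g (harm r))\<^sup>2)) =
        (real d ^ r * (real d * (u (Suc r) * u r))) * (g (harm (Suc r)) - g (harm r))\<^sup>2"
      by simp
    also have "\<dots> \<le> (sqrt (real d) * real (Suc r)) * (g (harm (Suc r)) - g (harm r))\<^sup>2"
      by (intro mult_right_mono weight) simp
    also have "\<dots> = sqrt (real d) * (real (Suc r) * (g (harm (Suc r)) - g (harm r))\<^sup>2)"
      by simp
    also have "\<dots> \<le> sqrt (real d) * (if harm r < M then 1 / real (Suc r) else 0)"
      by (intro mult_left_mono incr) simp
    finally show "real d ^ r * (real d * (u (Suc r) * u r * (g (harm (Suc r)) - g (harm r))\<^sup>2)) \<le> \<dots>" .
  qed
  also have "\<dots> \<le> sqrt (real d) * (M + 1)"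
    using sum_harm_increments_le[OF M, of "Suc N"]
    by (simp only: sum_distrib_left[symmetric] lessThan_Suc_atMost) (intro mult_left_mono, auto)
  finally have excess: "(\<Sum>y\<in>tree_ball d N. \<Sum>a<d. u (Suc (length y)) * u (length y) *
       (test_function d g (a # y) / u (Suc (length y)) - test_function d g y / u (length y))\<^sup>2)
       \<le> sqrt (real d) * (M + 1)" .
  have "energy (tree d) tree_edge (test_function d g) =
    weighted_norm_sq (tree d) tree_measure (\<lambda>x. hardy_profile d (length x)) (test_function d g) +
    (\<Sum>y\<in>tree_ball d N. \<Sum>a<d. u (Suc (length y)) * u (length y) *
       (test_function d g (a # y) / u (Suc (length y)) - test_function d g y / u (length y))\<^sup>2)"
    unfolding u_def using d supp by (intro hardy_identity) (auto simp: test_function_def)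
  with excess show ?thesis by simp
qed

lemma test_function_in_Cc:
  assumes van: "\<And>t. M \<le> t \<Longrightarrow> g t = 0" and K: "\<And>x. x \<in> K \<Longrightarrow> g (harm (length x)) = 0"
  shows "test_function d g \<in> Cc (tree d - {[]} - K)"
proof -
  obtain N where N: "\<And>r. N \<le> r \<Longrightarrow> M \<le> harm r"
    using harm_eventually_ge by blast
  have "{x. test_function d g x \<noteq> 0} \<subseteq> tree_ball d N"
  proof
    fix x assume "x \<in> {x. test_function d g x \<noteq> 0}"
    then have "x \<in> tree d" "g (harm (length x)) \<noteq> 0"
      by (auto simp: test_function_def split: if_splits)
    with N[of "length x"] van show "x \<in> tree_ball d N"
      by (cases "length x \<le> N") auto
  qed
  then have "finite {x. test_function d g x \<noteq> 0}"
    by (rule finite_subset) simp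
  then show ?thesis
    using K by (auto simp: Cc_def test_function_def)
qed


subsection \<open>Criticality\<close>

text \<open>
  A positive superharmonic \<open>v\<close> gives a second ground state transform. Along the cut-offs of the
  ground state by \<open>t \<mapsto> max 0 (n - t)\<close> its remainder is \<open>O(n)\<close>, which after division by \<open>n\<^sup>2\<close>
  forces every edge term to vanish in the limit.
\<close>

lemma superharmonic_edge_term:
  assumes d: "d \<ge> 1"
    and v: "positive_superharmonic (tree d) tree_edge tree_measure (tree d - {[]})
      (\<lambda>x. hardy_profile d (length x)) v"
    and y: "y \<in> tree d" "a < d"
  shows "v (a # y) * v y *
    (ground_profile d (Suc (length y)) / v (a # y) - ground_profile d (length y) / v y)\<^sup>2 = 0"
proof -
  let ?u = "\<lambda>x. ground_profile d (length x)"
  let ?h = "\<lambda>x. harm (length x) :: real"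
  let ?s = "sqrt (real d)"
  define T where "T = (\<lambda>\<phi> y a. v (a # y) * v y * (\<phi> (a # y) / v (a # y) - \<phi> y / v y)\<^sup>2)"
  have pos: "0 < v x" if "x \<in> tree d" "x \<noteq> []" for x
    using v that by (simp add: positive_superharmonic_def)
  have nonneg: "0 \<le> v x" if "x \<in> tree d" for x
    using v that by (simp add: positive_superharmonic_def)
  have sup: "hardy_profile d (length x) * v x \<le> tree_laplacian d v x" if "x \<in> tree d" "x \<noteq> []" for x
    using v that by (simp add: positive_superharmonic_def superharmonic_on_def neg_laplacian_tree)
  have bound: "v (a # y) * v y *
      (?u (a # y) / v (a # y) * (1 - ?h (a # y) / real n) - ?u y / v y * (1 - ?h y / real n))\<^sup>2
      \<le> ?s * (1 / real n + 1 / (real n)\<^sup>2)" if n: "?h (a # y) \<le> real n" for n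
  proof -
    \<comment> \<open>Once \<open>n\<close> is past the harmonic numbers of both ends of the fixed
      edge, the maximum is inactive there, and \<open>g\<close> divided by \<open>n\<close> is
      \<open>1 - t / n\<close>, which tends to 1.\<close>
    define g where "g = (\<lambda>t. max 0 (real n - t))"
    define \<phi> where "\<phi> = test_function d g"
    have hy: "?h y \<le> ?h (a # y)" by (simp add: harm_mono)
    have "0 < ?h (a # y)" by simp
    with n have n0: "real n > 0" by linarith
    have lip: "\<bar>g s - g t\<bar> \<le> \<bar>s - t\<bar>" for s t
      by (auto simp: g_def max_def)
    have van: "g t = 0" if "real n \<le> t" for t
      using that by (simp add: g_def)
    obtain N0 where N0: "\<And>r. N0 \<le> r \<Longrightarrow> real n \<le> harm r"
      using harm_eventually_ge by blast
    \<comment> \<open>The ball must also contain \<open>y\<close>, so that the fixed edge is among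
      the nonnegative terms of the sum.\<close>
    define N where "N = max N0 (length y)"
    have supp: "\<phi> x = 0" if "N < length x" for x
      using that N0[of "length x"] by (simp add: N_def \<phi>_def test_function_def van)
    have root: "\<phi> [] = 0" by (simp add: \<phi>_def test_function_def)
    have "hardy_profile d (length x) * (\<phi> x)\<^sup>2 \<le> (\<phi> x)\<^sup>2 / v x * tree_laplacian d v x"
      if x: "x \<in> tree d" for x
    proof (cases "x = []")
      case False
      have "(\<phi> x)\<^sup>2 / v x * (hardy_profile d (length x) * v x) \<le> (\<phi> x)\<^sup>2 / v x * tree_laplacian d v x"
        using pos[OF x False] by (intro mult_left_mono sup x False) simp
      then show ?thesis
        using pos[OF x False] by (simp add: mult.commute)
    qed (simp add: root)
    then have "weighted_norm_sq (tree d) tree_measure (\<lambda>x. hardy_profile d (length x)) \<phi> +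
        (\<Sum>y\<in>tree_ball d N. \<Sum>a<d. T \<phi> y a)
       \<le> (\<Sum>x\<in>tree_ball d N. (\<phi> x)\<^sup>2 / v x * tree_laplacian d v x) +
          (\<Sum>y\<in>tree_ball d N. \<Sum>a<d. T \<phi> y a)"
      by (subst weighted_norm_sq_tree[where N = N]) (auto simp: supp intro: sum_mono)
    also have "(\<Sum>x\<in>tree_ball d N. (\<phi> x)\<^sup>2 / v x * tree_laplacian d v x) +
        (\<Sum>y\<in>tree_ball d N. \<Sum>a<d. T \<phi> y a) = energy (tree d) tree_edge \<phi>"
      unfolding T_def
      by (subst energy_tree[where N = N], simp add: supp,
          subst ground_state_transform[where v = v]) (auto simp: pos supp root)
    also have "\<dots> \<le> weighted_norm_sq (tree d) tree_measure (\<lambda>x. hardy_profile d (length x)) \<phi> +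
        ?s * (real n + 1)"
      unfolding \<phi>_def by (rule test_function_energy[OF d _ lip van]) auto
    finally have total: "(\<Sum>y\<in>tree_ball d N. \<Sum>a<d. T \<phi> y a) \<le> ?s * (real n + 1)" by simp
    \<comment> \<open>At edges from the root this relies on \<open>v [] \<ge> 0\<close>, the sign
      condition off the domain.\<close>
    have T_nonneg: "0 \<le> T \<phi> y a" if "y \<in> tree d" "a < d" for y a
      using that pos nonneg by (auto simp: T_def intro!: mult_nonneg_nonneg less_imp_le)
    have "T \<phi> y a \<le> (\<Sum>a<d. T \<phi> y a)"
      using y T_nonneg by (intro member_le_sum) auto
    also have "\<dots> \<le> (\<Sum>y\<in>tree_ball d N. \<Sum>a<d. T \<phi> y a)"
      using y T_nonneg by (intro member_le_sum sum_nonneg) (auto simp: N_def)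
    also note total
    finally have "T \<phi> y a \<le> ?s * (real n + 1)" .
    moreover have "T \<phi> y a = (real n)\<^sup>2 * (v (a # y) * v y *
      (?u (a # y) / v (a # y) * (1 - ?h (a # y) / real n) - ?u y / v y * (1 - ?h y / real n))\<^sup>2)"
    proof -
      have gn: "g t = real n * (1 - t / real n)" if "t \<le> real n" for t
        using that n0 by (simp add: g_def right_diff_distrib)
      have "\<phi> (a # y) / v (a # y) - \<phi> y / v y = real n *
        (?u (a # y) / v (a # y) * (1 - ?h (a # y) / real n) - ?u y / v y * (1 - ?h y / real n))"
        unfolding \<phi>_def test_function_def using y gn[OF n] gn[OF order_trans[OF hy n]]
        by (simp add: right_diff_distrib diff_divide_distrib mult_ac)
      then show ?thesis by (simp add: T_def power_mult_distrib)
    qed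
    ultimately have "v (a # y) * v y *
      (?u (a # y) / v (a # y) * (1 - ?h (a # y) / real n) - ?u y / v y * (1 - ?h y / real n))\<^sup>2
      \<le> ?s * (real n + 1) / (real n)\<^sup>2"
      using n0 by (simp add: pos_le_divide_eq mult.commute)
    also have "\<dots> = ?s * (1 / real n + 1 / (real n)\<^sup>2)"
      using n0 by (simp add: field_simps power2_eq_square)
    finally show ?thesis .
  qed
  have "v (a # y) * v y * (?u (a # y) / v (a # y) * (1 - 0) - ?u y / v y * (1 - 0))\<^sup>2 \<le> ?s * (0 + 0)"
  proof (rule tendsto_le[OF trivial_limit_sequentially])
    show "(\<lambda>n. ?s * (1 / real n + 1 / (real n)\<^sup>2)) \<longlonglongrightarrow> ?s * (0 + 0)"
      by (intro tendsto_intros lim_1_over_n tendsto_divide_0[OF tendsto_const]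
            filterlim_at_top_imp_at_infinity filterlim_pow_at_top filterlim_real_sequentially) auto
    show "(\<lambda>n. v (a # y) * v y * (?u (a # y) / v (a # y) * (1 - ?h (a # y) / real n) -
        ?u y / v y * (1 - ?h y / real n))\<^sup>2)
        \<longlonglongrightarrow> v (a # y) * v y * (?u (a # y) / v (a # y) * (1 - 0) - ?u y / v y * (1 - 0))\<^sup>2"
      by (intro tendsto_intros lim_const_over_n)
    show "\<forall>\<^sub>F n in sequentially. v (a # y) * v y * (?u (a # y) / v (a # y) * (1 - ?h (a # y) / real n) -
        ?u y / v y * (1 - ?h y / real n))\<^sup>2 \<le> ?s * (1 / real n + 1 / (real n)\<^sup>2)"
      using bound filterlim_real_sequentially unfolding filterlim_at_top
      by (blast intro: eventually_mono)
  qed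
  moreover have "0 \<le> v (a # y) * v y * (?u (a # y) / v (a # y) - ?u y / v y)\<^sup>2"
    using y nonneg by (intro mult_nonneg_nonneg) auto
  ultimately show ?thesis by simp
qed

text \<open>The vanishing edge term at the root forces \<open>v [] = 0\<close>, because the profile
  is 0 there but positive at \<open>[a]\<close>. On all other edges it says that \<open>v\<close>
  divided by the profile does not change, so the ratio at \<open>[a]\<close> spreads over the
  branch.\<close>

lemma superharmonic_multiple_of_ground_state:
  assumes d: "d \<ge> 1"
    and v: "positive_superharmonic (tree d) tree_edge tree_measure (tree d - {[]})
      (\<lambda>x. hardy_profile d (length x)) v"
    and a: "a < d"
  obtains c where "c > 0"
    "\<And>x. x \<in> tree d \<Longrightarrow> x = [] \<or> last x = a \<Longrightarrow> v x = c * ground_profile d (length x)"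
proof -
  let ?u = "\<lambda>x. ground_profile d (length x)"
  have pos: "0 < v x" if "x \<in> tree d" "x \<noteq> []" for x
    using v that by (simp add: positive_superharmonic_def)
  have u_pos: "0 < ground_profile d r" if "0 < r" for r
    using d that by (simp add: ground_profile_pos)
  have u1: "ground_profile d (Suc 0) > 0" and va: "v [a] > 0"
    using a pos u_pos by auto
  have root: "v [] = 0"
    using superharmonic_edge_term[OF d v Nil_in_tree a] u1 va by simp
  have ratio: "v x = v [a] / ground_profile d 1 * ?u x"
    if "x \<in> tree d" "x \<noteq> []" "last x = a" for x
    using that
  proof (induction x)
    case (Cons b x)
    show ?case
    proof (cases "x = []")
      case True
      with Cons u1 show ?thesis by simp
    next
      case False
      have x: "x \<in> tree d" "b < d" using Cons.prems by auto
      have vx: "v x > 0" "v (b # x) > 0" using pos x False by auto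
      have ux: "?u x > 0" "?u (b # x) > 0" using u_pos False by auto
      have "ground_profile d (Suc (length x)) / v (b # x) = ?u x / v x"
        using superharmonic_edge_term[OF d v x] vx by simp
      then have "v (b # x) = v x / ?u x * ?u (b # x)"
        using vx ux by (simp add: field_simps)
      also have "v x / ?u x = v [a] / ground_profile d 1"
        using Cons.IH Cons.prems False ux by simp
      finally show ?thesis .
    qed
  qed simp
  show thesis
  proof (rule that)
    show "v [a] / ground_profile d 1 > 0" using u1 va by simp
    show "v x = v [a] / ground_profile d 1 * ?u x" if "x \<in> tree d" "x = [] \<or> last x = a" for x
      using that ratio root by (cases "x = []") auto
  qed
qed

lemma agmon_ground_state_tree:
  assumes d: "d \<ge> 1"
  shows "agmon_ground_state (tree d) tree_edge tree_measure (tree d - {[]})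
    (\<lambda>x. hardy_profile d (length x)) (\<lambda>x. ground_profile d (length x))"
  unfolding agmon_ground_state_def
proof (intro conjI allI impI ballI)
  have "0 \<le> ground_profile d r" for r by (simp add: ground_profile_def)
  then show "positive_superharmonic (tree d) tree_edge tree_measure (tree d - {[]})
     (\<lambda>x. hardy_profile d (length x)) (\<lambda>x. ground_profile d (length x))"
    using d by (auto simp: positive_superharmonic_def superharmonic_on_def neg_laplacian_tree
        tree_laplacian_ground_profile ground_profile_pos)
next
  fix v C
  assume v: "positive_superharmonic (tree d) tree_edge tree_measure (tree d - {[]})
     (\<lambda>x. hardy_profile d (length x)) v"
    and C: "C \<in> components (tree d - {[]}) tree_edge"
  obtain a where "a < d" and a: "closed_nbhd (tree d) tree_edge C \<subseteq> {x \<in> tree d. x = [] \<or> last x = a}"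
    using closed_nbhd_component_subset[OF C] .
  obtain c where "\<And>x. x \<in> tree d \<Longrightarrow> x = [] \<or> last x = a \<Longrightarrow> v x = c * ground_profile d (length x)"
    using superharmonic_multiple_of_ground_state[OF d v \<open>a < d\<close>] by blast
  with a show "\<exists>c. \<forall>x\<in>closed_nbhd (tree d) tree_edge C. v x = c * ground_profile d (length x)"
    by blast
qed

subsection \<open>Null-criticality and optimality near infinity\<close>

text \<open>The mass of the squared ground state on a sphere, the source of the harmonic divergence
  in the weighted norms.\<close>

lemma ground_profile_sq:
  "d \<ge> 1 \<Longrightarrow> real d ^ r * (ground_profile d r)\<^sup>2 = real r"
  by (simp add: ground_profile_def power_divide power_mult_distrib flip: power_mult)
     (simp add: mult.commute[of r] power_mult)

lemma null_critical_tree: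
  assumes d: "d \<ge> 1"
  shows "null_critical (tree d) tree_edge tree_measure (tree d - {[]})
    (\<lambda>x. hardy_profile d (length x))"
  unfolding null_critical_def
proof (intro conjI allI impI notI)
  show "critical (tree d) tree_edge tree_measure (tree d - {[]}) (\<lambda>x. hardy_profile d (length x))"
    unfolding critical_def using agmon_ground_state_tree[OF d] by blast
next
  fix v
  assume v: "agmon_ground_state (tree d) tree_edge tree_measure (tree d - {[]})
      (\<lambda>x. hardy_profile d (length x)) v"
    and sm: "(\<lambda>x. (v x)\<^sup>2 * hardy_profile d (length x) * tree_measure x) summable_on tree d - {[]}"
  \<comment> \<open>The constant of a ground state may differ from branch to branch, so divergence
    is shown on the branch with last letter 0 alone.\<close>
  obtain c where c: "c > 0" and
    vc: "\<And>x. x \<in> tree d \<Longrightarrow> x = [] \<or> last x = 0 \<Longrightarrow> v x = c * ground_profile d (length x)"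
    using superharmonic_multiple_of_ground_state[OF d, of v 0] v d
    by (auto simp: agmon_ground_state_def)
  let ?F = "\<lambda>r. (c * ground_profile d (Suc r))\<^sup>2 * hardy_profile d (Suc r)"
  \<comment> \<open>Appending 0 identifies the whole tree with this branch and raises the radius by
    one; the sum becomes radial over the tree.\<close>
  have "(\<lambda>x. (v x)\<^sup>2 * hardy_profile d (length x) * tree_measure x) summable_on
      ((\<lambda>x. x @ [0]) ` tree d)"
    by (rule summable_on_subset_banach[OF sm]) (use d in \<open>auto simp: tree_def\<close>)
  then have "(\<lambda>x. (v (x @ [0]))\<^sup>2 * hardy_profile d (Suc (length x))) summable_on tree d"
    by (subst (asm) summable_on_reindex) (auto simp: inj_on_def o_def tree_measure_def)
  also have "?this \<longleftrightarrow> (\<lambda>x. ?F (length x)) summable_on tree d"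
    by (intro summable_on_cong) (subst vc, use d in \<open>auto simp: tree_def\<close>)
  finally have sF: "(\<lambda>x. ?F (length x)) summable_on tree d" .
  define B where "B = infsum (\<lambda>x. ?F (length x)) (tree d)"
  have "c\<^sup>2 / real d * (sqrt (real d) / 4) * harm n \<le> B" for n
  proof -
    have "c\<^sup>2 / real d * (sqrt (real d) / 4) * harm n =
        (\<Sum>r<n. c\<^sup>2 / real d * (sqrt (real d) / 4) * (1 / real (Suc r)))"
      by (simp add: harm_altdef sum_distrib_left inverse_eq_divide)
    also have "\<dots> \<le> (\<Sum>r<n. real d ^ r * ?F r)"
    proof (rule sum_mono)
      fix r
      have "c\<^sup>2 / real d * (sqrt (real d) / 4) * (1 / real (Suc r)) =
          c\<^sup>2 / real d * (real (Suc r) * (sqrt (real d) / (4 * (real (Suc r))\<^sup>2)))"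
        using d by (simp add: divide_simps power2_eq_square)
      also have "\<dots> \<le> c\<^sup>2 / real d * (real (Suc r) * hardy_profile d (Suc r))"
        by (intro mult_left_mono hardy_profile_ge) auto
      also have "\<dots> = real d ^ r * ?F r"
        unfolding ground_profile_sq[OF d, of "Suc r", symmetric]
        using d by (simp add: field_simps power_mult_distrib)
      finally show "c\<^sup>2 / real d * (sqrt (real d) / 4) * (1 / real (Suc r)) \<le> real d ^ r * ?F r" .
    qed
    also have "\<dots> \<le> (\<Sum>r\<le>n. real d ^ r * ?F r)"
      using hardy_profile_pos[OF d] by (intro sum_mono2) (auto simp: less_imp_le)
    also have "\<dots> = (\<Sum>x\<in>tree_ball d n. ?F (length x))"
      by (rule sum_tree_ball_radial[symmetric])
    also have "\<dots> \<le> B"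
      unfolding B_def using hardy_profile_pos[OF d]
      by (intro sum_tree_ball_le_infsum sF) (auto simp: less_imp_le)
    finally show ?thesis .
  qed
  moreover define k where "k = c\<^sup>2 / real d * (sqrt (real d) / 4)"
  ultimately have kB: "k * harm n \<le> B" for n by simp
  have k: "k > 0" using c d by (simp add: k_def)
  obtain n where "B / k + 1 \<le> (harm n :: real)"
    using harm_eventually_ge[of "B / k + 1"] by blast
  with kB[of n] k show False
    by (simp add: field_simps)
qed

lemma harm_hits:
  assumes "0 \<le> t"
  obtains n where "t \<le> harm n" "harm n \<le> t + (1 :: real)"
proof -
  have ex: "\<exists>n. t \<le> harm n"
    using harm_eventually_ge[of t] by blast
  define n where "n = (LEAST n. t \<le> harm n)"
  have "t \<le> harm n" unfolding n_def by (rule LeastI_ex[OF ex])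
  moreover have "harm n \<le> t + 1"
  proof (cases n)
    case 0
    with assms show ?thesis by (simp add: harm_expand)
  next
    case (Suc m)
    then have "harm m < t"
      using not_less_Least[of m "\<lambda>n. t \<le> harm n"] by (simp add: n_def not_le)
    moreover have "1 / (1 + real m) \<le> 1" by simp
    ultimately show ?thesis
      unfolding Suc harm_Suc inverse_eq_divide of_nat_Suc by linarith
  qed
  ultimately show thesis by (rule that)
qed

lemma harm_diff:
  assumes "m \<le> n"
  shows "harm n - harm m = (\<Sum>r\<in>{m<..n}. 1 / real r)"
  using assms
proof (induction n rule: dec_induct)
  case (step n)
  then have "{m<..Suc n} = insert (Suc n) {m<..n}" by auto
  with step show ?case by (simp add: harm_Suc inverse_eq_divide)
qed simp

text \<open>On the window where \<open>g \<ge> L\<close>, the sphere of radius \<open>r\<close>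
  contributes at least \<open>sqrt d / 4 * L^2 / r\<close>, and these reciprocals add up to at least
  \<open>2 * L - 2\<close>. The norm is thus cubic in \<open>L\<close>.\<close>

lemma test_function_norm_ge:
  assumes d: "d \<ge> 1" and L: "L \<ge> 2" and A: "A \<ge> 0"
    and lower: "\<And>t. A + L \<le> t \<Longrightarrow> t \<le> A + 3 * L \<Longrightarrow> L \<le> g t"
    and van: "\<And>t. M \<le> t \<Longrightarrow> g t = 0"
  shows "sqrt (real d) / 4 * L\<^sup>2 * (2 * L - 2) \<le>
    weighted_norm_sq (tree d) tree_measure (\<lambda>x. hardy_profile d (length x)) (test_function d g)"
proof -
  obtain m where m: "A + L \<le> harm m" "harm m \<le> A + L + 1"
    using harm_hits[of "A + L"] L A by auto
  \<comment> \<open>Aiming one unit below the right end keeps the overshoot inside the window; each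
    end costs at most 1.\<close>
  obtain n where n: "A + 3 * L - 1 \<le> harm n" "harm n \<le> A + 3 * L"
    using harm_hits[of "A + 3 * L - 1"] L A by auto
  have "m \<le> n"
  proof (rule ccontr)
    assume "\<not> m \<le> n"
    then have "harm n \<le> (harm m :: real)" by (intro harm_mono) simp
    with m n L show False by simp
  qed
  obtain N0 where N0: "\<And>r. N0 \<le> r \<Longrightarrow> M \<le> harm r"
    using harm_eventually_ge by blast
  define N where "N = max N0 n"
  have supp: "test_function d g x = 0" if "N < length x" for x
    using that N0[of "length x"] by (simp add: test_function_def van N_def)
  have "sqrt (real d) / 4 * L\<^sup>2 * (2 * L - 2) \<le> sqrt (real d) / 4 * L\<^sup>2 * (harm n - harm m)"
    using m n by (intro mult_left_mono) auto
  also have "\<dots> = (\<Sum>r\<in>{m<..n}. sqrt (real d) / 4 * L\<^sup>2 * (1 / real r))"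
    by (simp only: harm_diff[OF \<open>m \<le> n\<close>] sum_distrib_left)
  also have "\<dots> \<le> (\<Sum>r\<in>{m<..n}. real d ^ r * (hardy_profile d r * (ground_profile d r * g (harm r))\<^sup>2))"
  proof (rule sum_mono)
    fix r assume r: "r \<in> {m<..n}"
    then have "harm m \<le> (harm r :: real)" "harm r \<le> (harm n :: real)"
      by (auto intro!: harm_mono)
    then have "L \<le> g (harm r)" using m n by (intro lower) auto
    then have "L\<^sup>2 \<le> (g (harm r))\<^sup>2" using L by (intro power_mono) auto
    have "sqrt (real d) / 4 * L\<^sup>2 * (1 / real r) =
        real r * (sqrt (real d) / (4 * (real r)\<^sup>2)) * L\<^sup>2"
      using r by (simp add: field_simps power2_eq_square)
    also have "\<dots> \<le> real r * hardy_profile d r * (g (harm r))\<^sup>2"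
      using r \<open>L\<^sup>2 \<le> (g (harm r))\<^sup>2\<close>
      by (intro mult_mono mult_left_mono hardy_profile_ge mult_nonneg_nonneg
            less_imp_le[OF hardy_profile_pos[OF d]]) auto
    also have "\<dots> = real d ^ r * (hardy_profile d r * (ground_profile d r * g (harm r))\<^sup>2)"
      unfolding ground_profile_sq[OF d, of r, symmetric] by (simp add: power_mult_distrib mult_ac)
    finally show "sqrt (real d) / 4 * L\<^sup>2 * (1 / real r) \<le> \<dots>" .
  qed
  also have "\<dots> \<le> (\<Sum>r\<le>N. real d ^ r * (hardy_profile d r * (ground_profile d r * g (harm r))\<^sup>2))"
  proof (rule sum_mono2)
    fix r
    show "0 \<le> real d ^ r * (hardy_profile d r * (ground_profile d r * g (harm r))\<^sup>2)"
      using hardy_profile_pos[OF d, of r] by (cases "r = 0") (auto simp: Suc_le_eq)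
  qed (auto simp: N_def)
  also have "\<dots> = (\<Sum>x\<in>tree_ball d N. hardy_profile d (length x) * 
      (ground_profile d (length x) * g (harm (length x)))\<^sup>2)"
    by (rule sum_tree_ball_radial[symmetric])
  also have "\<dots> = (\<Sum>x\<in>tree_ball d N. hardy_profile d (length x) * (test_function d g x)\<^sup>2)"
    by (intro sum.cong) (auto simp: test_function_def)
  also have "\<dots> = weighted_norm_sq (tree d) tree_measure (\<lambda>x. hardy_profile d (length x)) (test_function d g)"
    by (subst weighted_norm_sq_tree[where N = N]) (simp_all add: supp)
  finally show ?thesis .
qed

text \<open>For a tent of width \<open>4 * L\<close> in the harmonic coordinate, the energy exceeds
  the weighted norm by a term linear in \<open>L\<close>, while the norm is cubic in
  \<open>L\<close>. No factor \<open>1 + \<epsilon>\<close> survives for large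
  \<open>L\<close>.\<close>

lemma optimal_near_infinity_tree:
  assumes d: "d \<ge> 1"
  shows "optimal_near_infinity (tree d) tree_edge tree_measure (tree d - {[]})
    (\<lambda>x. hardy_profile d (length x))"
  unfolding optimal_near_infinity_def
proof (intro allI impI notI, elim conjE)
  let ?W = "weighted_norm_sq (tree d) tree_measure (\<lambda>x. hardy_profile d (length x))"
  fix \<epsilon> :: real and K
  assume \<epsilon>: "\<epsilon> > 0" and K: "finite K" "K \<subseteq> tree d - {[]}"
    and ineq: "\<forall>\<phi>\<in>Cc (tree d - {[]} - K). weighted_norm_sq (tree d) tree_measure
        (\<lambda>x. (1 + \<epsilon>) * hardy_profile d (length x)) \<phi> \<le> energy (tree d) tree_edge \<phi>"
  \<comment> \<open>The tent \<open>g\<close> starts at level \<open>A\<close>, beyond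
    \<open>K\<close>, and has height \<open>2 * L\<close>, so it is at least \<open>L\<close> on the
    middle half. Inserting 0 covers empty \<open>K\<close>. The choice of \<open>L\<close> gives
    \<open>A + 4 * L + 1 \<le> 5 * L\<close> and contradicts
    \<open>\<epsilon> * L^2 \<le> 20\<close>.\<close>
  define A :: real where "A = harm (Max (insert 0 (length ` K)))"
  define L where "L = A + 2 + 20 / \<epsilon>"
  define g where "g = (\<lambda>t. max 0 (2 * L - \<bar>t - (A + 2 * L)\<bar>))"
  have A: "A \<ge> 0" by (simp add: A_def harm_nonneg)
  have L: "L \<ge> 2" "L \<ge> A + 2" "L > 20 / \<epsilon>" using A \<epsilon> by (auto simp: L_def)
  have lip: "\<bar>g s - g t\<bar> \<le> \<bar>s - t\<bar>" for s t
    by (auto simp: g_def max_def)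
  have van: "g t = 0" if "A + 4 * L \<le> t" for t
    using that by (auto simp: g_def)
  have gK: "g (harm (length x)) = 0" if "x \<in> K" for x
  proof -
    have "harm (length x) \<le> A"
      unfolding A_def using that K by (intro harm_mono) auto
    then show ?thesis by (auto simp: g_def)
  qed
  let ?\<phi> = "test_function d g"
  have "(1 + \<epsilon>) * ?W ?\<phi> \<le> energy (tree d) tree_edge ?\<phi>"
  proof -
    have Cc: "?\<phi> \<in> Cc (tree d - {[]} - K)"
      using van gK by (rule test_function_in_Cc)
    then have "?\<phi> \<in> Cc (tree d - {[]})" by (auto simp: Cc_def)
    then obtain N where supp: "\<And>x. N < length x \<Longrightarrow> ?\<phi> x = 0"
      using Cc_tree_bounded by blast
    have "weighted_norm_sq (tree d) tree_measure (\<lambda>x. (1 + \<epsilon>) * hardy_profile d (length x)) ?\<phi> =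
        (1 + \<epsilon>) * ?W ?\<phi>"
      by (subst (1 2) weighted_norm_sq_tree[where N = N])
         (simp_all add: supp sum_distrib_left mult.assoc)
    with bspec[OF ineq Cc] show ?thesis by simp
  qed
  also have "\<dots> \<le> ?W ?\<phi> + sqrt (real d) * (A + 4 * L + 1)"
    using A L by (intro test_function_energy[OF d _ lip van]) auto
  finally have "\<epsilon> * ?W ?\<phi> \<le> sqrt (real d) * (A + 4 * L + 1)"
    by (simp add: algebra_simps)
  moreover have "sqrt (real d) / 4 * L\<^sup>2 * (2 * L - 2) \<le> ?W ?\<phi>"
    by (rule test_function_norm_ge[OF d L(1) A _ van]) (auto simp: g_def)
  then have "\<epsilon> * (sqrt (real d) / 4 * L\<^sup>2 * (2 * L - 2)) \<le> \<epsilon> * ?W ?\<phi>"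
    using \<epsilon> by (intro mult_left_mono) auto
  ultimately have "\<epsilon> * (sqrt (real d) / 4 * L\<^sup>2 * (2 * L - 2)) \<le> sqrt (real d) * (A + 4 * L + 1)"
    by linarith
  also have "\<epsilon> * (sqrt (real d) / 4 * L\<^sup>2 * (2 * L - 2)) = sqrt (real d) * (\<epsilon> / 4 * L\<^sup>2 * (2 * L - 2))"
    by simp
  finally have "sqrt (real d) * (\<epsilon> / 4 * L\<^sup>2 * (2 * L - 2)) \<le> sqrt (real d) * (A + 4 * L + 1)" .
  then have "\<epsilon> / 4 * L\<^sup>2 * (2 * L - 2) \<le> A + 4 * L + 1"
    using d by simp
  moreover have "\<epsilon> / 4 * L\<^sup>2 * L \<le> \<epsilon> / 4 * L\<^sup>2 * (2 * L - 2)"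
    using L \<epsilon> by (intro mult_left_mono) auto
  ultimately have "\<epsilon> / 4 * L\<^sup>2 * L \<le> 5 * L"
    using L by linarith
  then have "\<epsilon> * L * L \<le> 20"
    using L by (simp add: power2_eq_square)
  moreover have "\<epsilon> * L > 20" using L \<epsilon> by (simp add: field_simps)
  then have "\<epsilon> * L * L > 20 * 1" using L by (intro mult_strict_mono) auto
  ultimately show False by simp
qed

subsection \<open>The bottom of the spectrum\<close>

text \<open>
  With \<open>\<mu> = d + 1 - c\<close> the shifted Laplacian is \<open>c - B\<close>, where \<open>B\<close> is the following operator.
  At the root \<open>f (tl [])\<close> stands for the value at the root itself, so that the
  diagonal of the Laplacian becomes constant.
\<close>

definition neighbour_sum :: "nat \<Rightarrow> (nat list \<Rightarrow> real) \<Rightarrow> nat list \<Rightarrow> real" where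
  "neighbour_sum d f x = f (tl x) + (\<Sum>a<d. f (a # x))"

lemma shifted_laplacian_tree:
  "shifted_laplacian (tree d) tree_edge tree_measure \<mu> f =
    (\<lambda>x. if x \<in> tree d then (real d + 1 - \<mu>) * f x - neighbour_sum d f x else 0)"
  by (rule ext)
     (simp add: shifted_laplacian_def neg_laplacian_tree tree_laplacian_def neighbour_sum_def
       sum_subtractf algebra_simps)

text \<open>Splitting parent from children costs a factor 2, and Cauchy-Schwarz over the children a
  factor \<open>d\<close>. A value occurs at most \<open>d\<close> times as a parent and once as a
  child, in total \<open>2 * d + 2 * d\<close>. The root also counts as its own parent, but it is
  nobody's child, which compensates since \<open>d \<ge> 1\<close>.\<close>

lemma sum_neighbour_sum_sq_le:
  assumes d: "d \<ge> 1"
  shows "(\<Sum>x\<in>tree_ball d N. (neighbour_sum d f x)\<^sup>2) \<le>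
    4 * real d * (\<Sum>x\<in>tree_ball d (Suc N). (f x)\<^sup>2)"
proof -
  let ?S = "\<lambda>N. \<Sum>x\<in>tree_ball d N. (f x)\<^sup>2"
  have point: "(neighbour_sum d f x)\<^sup>2 \<le> 2 * (f (tl x))\<^sup>2 + 2 * real d * (\<Sum>a<d. (f (a # x))\<^sup>2)" for x
  proof -
    have "(\<Sum>a<d. f (a # x))\<^sup>2 \<le> real d * (\<Sum>a<d. (f (a # x))\<^sup>2)"
      using Cauchy_Schwarz_ineq_sum[of "\<lambda>a. f (a # x)" "\<lambda>_. 1" "{..<d}"] by (simp add: mult.commute)
    moreover have "(neighbour_sum d f x)\<^sup>2 \<le> 2 * (f (tl x))\<^sup>2 + 2 * (\<Sum>a<d. f (a # x))\<^sup>2"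
      using sum_squares_bound[of "f (tl x)" "\<Sum>a<d. f (a # x)"]
      by (simp add: neighbour_sum_def power2_sum)
    ultimately show ?thesis by linarith
  qed
  have tl: "(\<Sum>x\<in>tree_ball d N. (f (tl x))\<^sup>2) \<le> (f [])\<^sup>2 + real d * ?S (Suc N)"
  proof (cases N)
    case 0
    have "tree_ball d 0 = {[]}" by auto
    then show ?thesis using 0 by (simp add: sum_nonneg)
  next
    case (Suc M)
    have "?S M \<le> ?S (Suc N)"
      using Suc by (intro sum_mono2) auto
    then show ?thesis
      unfolding Suc sum_tree_ball_Suc[of "\<lambda>x. (f (tl x))\<^sup>2"]
      by (simp add: mult_left_mono flip: sum_distrib_left)
  qed
  have "(\<Sum>x\<in>tree_ball d N. (neighbour_sum d f x)\<^sup>2) \<le>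
      2 * (\<Sum>x\<in>tree_ball d N. (f (tl x))\<^sup>2) +
      2 * real d * (\<Sum>x\<in>tree_ball d N. \<Sum>a<d. (f (a # x))\<^sup>2)"
    unfolding sum_distrib_left[of 2] sum_distrib_left[of "2 * real d"] sum.distrib[symmetric]
    by (intro sum_mono) (use point in \<open>simp add: sum_distrib_left\<close>)
  also have "(\<Sum>x\<in>tree_ball d N. \<Sum>a<d. (f (a # x))\<^sup>2) = ?S (Suc N) - (f [])\<^sup>2"
    by (simp add: sum_tree_ball_Suc)
  also have "2 * (\<Sum>x\<in>tree_ball d N. (f (tl x))\<^sup>2) + 2 * real d * (?S (Suc N) - (f [])\<^sup>2)
      \<le> 4 * real d * ?S (Suc N) + 2 * ((f [])\<^sup>2 - real d * (f [])\<^sup>2)"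
    using tl by (simp add: algebra_simps)
  also have "\<dots> \<le> 4 * real d * ?S (Suc N)"
    using mult_right_mono[of 1 "real d" "(f [])\<^sup>2"] d by simp
  finally show ?thesis .
qed

section \<open>Square summable functions on the tree\<close>

abbreviation tree_norm_sq :: "nat \<Rightarrow> (nat list \<Rightarrow> real) \<Rightarrow> real" where
  "tree_norm_sq d \<equiv> weighted_norm_sq (tree d) tree_measure (\<lambda>_. 1)"

lemma tree_norm_sq_eq: "tree_norm_sq d f = infsum (\<lambda>x. (f x)\<^sup>2) (tree d)"
  by (simp add: weighted_norm_sq_def tree_measure_def)

lemma ell2_tree_iff:
  "f \<in> ell2 (tree d) tree_measure \<longleftrightarrow>
    (\<forall>x. x \<notin> tree d \<longrightarrow> f x = 0) \<and> (\<lambda>x. (f x)\<^sup>2) summable_on tree d"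
  by (simp add: ell2_def tree_measure_def)

lemma ell2_treeI:
  assumes "\<And>x. x \<notin> tree d \<Longrightarrow> f x = 0" "\<And>N. (\<Sum>x\<in>tree_ball d N. (f x)\<^sup>2) \<le> M"
  shows "f \<in> ell2 (tree d) tree_measure" "tree_norm_sq d f \<le> M"
  using tree_summable_bounded[of d "\<lambda>x. (f x)\<^sup>2" M] assms
  by (auto simp: ell2_tree_iff tree_norm_sq_eq)

lemma ell2_treeD:
  assumes "f \<in> ell2 (tree d) tree_measure"
  shows "\<And>x. x \<notin> tree d \<Longrightarrow> f x = 0" "(\<Sum>x\<in>tree_ball d N. (f x)\<^sup>2) \<le> tree_norm_sq d f"
  using assms sum_tree_ball_le_infsum[of "\<lambda>x. (f x)\<^sup>2" d N]
  by (auto simp: ell2_tree_iff tree_norm_sq_eq)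

lemma ell2_tree_diff:
  assumes f: "f \<in> ell2 (tree d) tree_measure" and g: "g \<in> ell2 (tree d) tree_measure"
  shows "(\<lambda>x. f x - g x) \<in> ell2 (tree d) tree_measure"
proof (rule ell2_treeI(1))
  fix N
  have "(p - q)\<^sup>2 \<le> 2 * p\<^sup>2 + 2 * q\<^sup>2" for p q :: real
    using sum_squares_bound[of p "- q"] by (simp add: power2_diff)
  then have "(\<Sum>x\<in>tree_ball d N. (f x - g x)\<^sup>2) \<le>
      2 * (\<Sum>x\<in>tree_ball d N. (f x)\<^sup>2) + 2 * (\<Sum>x\<in>tree_ball d N. (g x)\<^sup>2)"
    unfolding sum_distrib_left sum.distrib[symmetric] by (rule sum_mono)
  also have "\<dots> \<le> 2 * tree_norm_sq d f + 2 * tree_norm_sq d g"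
    by (intro add_mono mult_left_mono ell2_treeD(2) f g) auto
  finally show "(\<Sum>x\<in>tree_ball d N. (f x - g x)\<^sup>2) \<le> 2 * tree_norm_sq d f + 2 * tree_norm_sq d g" .
qed (simp add: ell2_treeD(1)[OF f] ell2_treeD(1)[OF g])

lemma shifted_laplacian_in_ell2:
  assumes d: "d \<ge> 1" and f: "f \<in> ell2 (tree d) tree_measure"
  shows "shifted_laplacian (tree d) tree_edge tree_measure \<mu> f \<in> ell2 (tree d) tree_measure"
proof -
  define c where "c = real d + 1 - \<mu>"
  have "(\<lambda>x. c * f x) \<in> ell2 (tree d) tree_measure"
    using f by (simp add: ell2_tree_iff power_mult_distrib summable_on_cmult_right)
  moreover have "(\<lambda>x. if x \<in> tree d then neighbour_sum d f x else 0) \<in> ell2 (tree d) tree_measure"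
  proof (rule ell2_treeI(1))
    fix N
    have "(\<Sum>x\<in>tree_ball d N. (if x \<in> tree d then neighbour_sum d f x else 0)\<^sup>2) =
        (\<Sum>x\<in>tree_ball d N. (neighbour_sum d f x)\<^sup>2)"
      by (intro sum.cong) auto
    also have "\<dots> \<le> 4 * real d * (\<Sum>x\<in>tree_ball d (Suc N). (f x)\<^sup>2)"
      by (rule sum_neighbour_sum_sq_le[OF d])
    also have "\<dots> \<le> 4 * real d * tree_norm_sq d f"
      by (intro mult_left_mono ell2_treeD(2) f) simp
    finally show "(\<Sum>x\<in>tree_ball d N. (if x \<in> tree d then neighbour_sum d f x else 0)\<^sup>2)
      \<le> 4 * real d * tree_norm_sq d f" .
  qed simp
  ultimately have "(\<lambda>x. c * f x - (if x \<in> tree d then neighbour_sum d f x else 0))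
      \<in> ell2 (tree d) tree_measure"
    by (rule ell2_tree_diff)
  also have "(\<lambda>x. c * f x - (if x \<in> tree d then neighbour_sum d f x else 0)) =
      shifted_laplacian (tree d) tree_edge tree_measure \<mu> f"
    by (auto simp: shifted_laplacian_tree c_def ell2_treeD(1)[OF f])
  finally show ?thesis .
qed

section \<open>Inverting \<open>c - B\<close> when \<open>c ^ 2\<close> exceeds
  \<open>4 * d\<close>\<close>

definition resolvent_delta :: "nat \<Rightarrow> real \<Rightarrow> real" where
  "resolvent_delta d c = (c\<^sup>2 - 4 * real d) / 2"

definition resolvent_const :: "nat \<Rightarrow> real \<Rightarrow> real" where
  "resolvent_const d c = 1 + 4 * real d / resolvent_delta d c"

text \<open>
  The inequality \<open>(p + q)\<^sup>2 \<le> (1 + 1 / t) p\<^sup>2 + (1 + t) q\<^sup>2\<close> with \<open>t = \<delta> / (4 d)\<close>; here \<open>\<delta>\<close> is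
  half of \<open>c\<^sup>2 - 4 d\<close>, so that \<open>4 d (1 + t) = c\<^sup>2 - \<delta>\<close>.
\<close>

lemma resolvent_step:
  assumes d: "d \<ge> 1" and c: "4 * real d < c\<^sup>2"
    and equation: "\<And>x. x \<in> tree d \<Longrightarrow> c * f x = g x + neighbour_sum d h x"
    and G: "\<And>N. (\<Sum>x\<in>tree_ball d N. (g x)\<^sup>2) \<le> G"
    and H: "\<And>N. (\<Sum>x\<in>tree_ball d N. (h x)\<^sup>2) \<le> H"
  shows "c\<^sup>2 * (\<Sum>x\<in>tree_ball d N. (f x)\<^sup>2) \<le>
    resolvent_const d c * G + (c\<^sup>2 - resolvent_delta d c) * H"
proof -
  define t where "t = resolvent_delta d c / (4 * real d)"
  have t: "t > 0" using d c by (simp add: t_def resolvent_delta_def)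
  have coeffs: "1 + 1 / t = resolvent_const d c" "(1 + t) * (4 * real d) = c\<^sup>2 - resolvent_delta d c"
    using d by (simp_all add: t_def resolvent_const_def resolvent_delta_def field_simps)
  have young: "(p + q)\<^sup>2 \<le> (1 + 1 / t) * p\<^sup>2 + (1 + t) * q\<^sup>2" for p q :: real
  proof -
    have "0 \<le> (p - t * q)\<^sup>2 / t" using t by simp
    also have "\<dots> = (1 + 1 / t) * p\<^sup>2 + (1 + t) * q\<^sup>2 - (p + q)\<^sup>2"
      using t by (simp add: field_simps power2_eq_square)
    finally show ?thesis by simp
  qed
  have "c\<^sup>2 * (\<Sum>x\<in>tree_ball d N. (f x)\<^sup>2) = (\<Sum>x\<in>tree_ball d N. (g x + neighbour_sum d h x)\<^sup>2)"
    unfolding sum_distrib_left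
    by (intro sum.cong refl) (simp add: power_mult_distrib[symmetric] equation)
  also have "\<dots> \<le> (1 + 1 / t) * (\<Sum>x\<in>tree_ball d N. (g x)\<^sup>2) +
      (1 + t) * (\<Sum>x\<in>tree_ball d N. (neighbour_sum d h x)\<^sup>2)"
    unfolding sum_distrib_left sum.distrib[symmetric] by (intro sum_mono young)
  also have "\<dots> \<le> (1 + 1 / t) * G + (1 + t) * (4 * real d * H)"
  proof (intro add_mono mult_left_mono G)
    have "(\<Sum>x\<in>tree_ball d N. (neighbour_sum d h x)\<^sup>2) \<le>
        4 * real d * (\<Sum>x\<in>tree_ball d (Suc N). (h x)\<^sup>2)"
      by (rule sum_neighbour_sum_sq_le[OF d])
    also have "\<dots> \<le> 4 * real d * H" by (intro mult_left_mono H) simp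
    finally show "(\<Sum>x\<in>tree_ball d N. (neighbour_sum d h x)\<^sup>2) \<le> 4 * real d * H" .
  qed (use t in auto)
  also have "(1 + t) * (4 * real d * H) = ((1 + t) * (4 * real d)) * H" by simp
  finally show ?thesis
    unfolding coeffs .
qed

text \<open>The step estimate with \<open>h = f\<close>: absorbing the last term on the left leaves
  \<open>resolvent_delta d c\<close> times the norm of \<open>f\<close>.\<close>

lemma resolvent_a_priori:
  assumes d: "d \<ge> 1" and c: "4 * real d < c\<^sup>2"
    and f: "f \<in> ell2 (tree d) tree_measure" and g: "g \<in> ell2 (tree d) tree_measure"
    and equation: "\<And>x. x \<in> tree d \<Longrightarrow> c * f x = g x + neighbour_sum d f x"
  shows "tree_norm_sq d f \<le> resolvent_const d c / resolvent_delta d c * tree_norm_sq d g"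
proof -
  let ?\<delta> = "resolvent_delta d c"
  have \<delta>: "?\<delta> > 0" using c by (simp add: resolvent_delta_def)
  have c2: "c\<^sup>2 > 0" using c by (rule le_less_trans[rotated]) simp
  have "c\<^sup>2 * (\<Sum>x\<in>tree_ball d N. (f x)\<^sup>2) \<le>
      resolvent_const d c * tree_norm_sq d g + (c\<^sup>2 - ?\<delta>) * tree_norm_sq d f" for N
    by (rule resolvent_step[OF d c equation ell2_treeD(2)[OF g] ell2_treeD(2)[OF f]])
  then have "(\<Sum>x\<in>tree_ball d N. (f x)\<^sup>2) \<le>
      (resolvent_const d c * tree_norm_sq d g + (c\<^sup>2 - ?\<delta>) * tree_norm_sq d f) / c\<^sup>2" for N
    using c2 by (simp add: pos_le_divide_eq mult.commute)
  then have "tree_norm_sq d f \<le>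
      (resolvent_const d c * tree_norm_sq d g + (c\<^sup>2 - ?\<delta>) * tree_norm_sq d f) / c\<^sup>2"
    using ell2_treeD(1)[OF f] by (intro ell2_treeI(2)) auto
  then have "?\<delta> * tree_norm_sq d f \<le> resolvent_const d c * tree_norm_sq d g"
    using c2 by (simp add: pos_le_divide_eq algebra_simps)
  then show ?thesis
    using \<delta> by (simp add: field_simps)
qed

text \<open>Iterating \<open>f \<mapsto> (g + B f) / c\<close> from 0 gives an increasing sequence,
  since \<open>g\<close> and \<open>B\<close> preserve order and sign. Uniform bounds on balls yield
  pointwise limits, and the equation, having finitely many terms at each vertex, passes to the
  limit.\<close>

lemma resolvent_exists_nonneg:
  assumes d: "d \<ge> 1" and c: "4 * real d < c\<^sup>2" "c > 0"
    and g: "g \<in> ell2 (tree d) tree_measure" and nonneg: "\<And>x. 0 \<le> g x"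
  obtains f where "f \<in> ell2 (tree d) tree_measure"
    "\<And>x. x \<in> tree d \<Longrightarrow> c * f x = g x + neighbour_sum d f x"
proof -
  let ?\<delta> = "resolvent_delta d c"
  define G where "G = tree_norm_sq d g"
  \<comment> \<open>The fixed point of the bound in \<open>resolvent_step\<close>: with
    \<open>H = M\<close> its right side is exactly \<open>c^2 * M\<close>.\<close>
  define M where "M = resolvent_const d c / ?\<delta> * G"
  define F where "F = rec_nat (\<lambda>_. 0)
    (\<lambda>_ f x. if x \<in> tree d then (g x + neighbour_sum d f x) / c else 0)"
  have F_0: "F 0 = (\<lambda>_. 0)"
    and F_Suc: "F (Suc n) = (\<lambda>x. if x \<in> tree d then (g x + neighbour_sum d (F n) x) / c else 0)" for n
    unfolding F_def by simp_all
  have \<delta>: "?\<delta> > 0" using c by (simp add: resolvent_delta_def)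
  have G: "(\<Sum>x\<in>tree_ball d N. (g x)\<^sup>2) \<le> G" for N
    unfolding G_def by (rule ell2_treeD(2)[OF g])
  have G0: "G \<ge> 0" using G[of 0] by (rule order_trans[rotated]) (simp add: sum_nonneg)
  have M0: "M \<ge> 0" using \<delta> G0 by (simp add: M_def resolvent_const_def)
  have bound: "(\<Sum>x\<in>tree_ball d N. (F n x)\<^sup>2) \<le> M" for n N
  proof (induction n arbitrary: N)
    case 0
    then show ?case using M0 by (simp add: F_0)
  next
    case (Suc n)
    have "c\<^sup>2 * (\<Sum>x\<in>tree_ball d N. (F (Suc n) x)\<^sup>2) \<le> resolvent_const d c * G + (c\<^sup>2 - ?\<delta>) * M"
      by (rule resolvent_step[OF d c(1) _ G Suc.IH]) (use c in \<open>simp add: F_Suc\<close>)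
    also have "\<dots> = c\<^sup>2 * M"
      using \<delta> by (simp add: M_def field_simps)
    finally show ?case using c by simp
  qed
  have F_nonneg: "0 \<le> F n x" for n x
    by (induction n arbitrary: x)
       (use c nonneg in \<open>auto simp: F_0 F_Suc neighbour_sum_def intro!: divide_nonneg_pos add_nonneg_nonneg sum_nonneg\<close>)
  have F_mono: "F n x \<le> F (Suc n) x" for n x
  proof (induction n arbitrary: x)
    case 0
    then show ?case using F_nonneg[of "Suc 0" x] by (simp add: F_0)
  next
    case (Suc n)
    have "neighbour_sum d (F n) x \<le> neighbour_sum d (F (Suc n)) x"
      unfolding neighbour_sum_def by (intro add_mono sum_mono Suc.IH)
    then show ?case
      unfolding F_Suc[of "Suc n"] F_Suc[of n] using c by (auto simp: divide_right_mono simp flip: F_Suc)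
  qed
  have conv: "convergent (\<lambda>n. F n x)" for x
  proof -
    have "F n x \<le> sqrt M" for n
    proof (cases "x \<in> tree d")
      case True
      have "(F n x)\<^sup>2 \<le> (\<Sum>x\<in>tree_ball d (length x). (F n x)\<^sup>2)"
        using True by (intro member_le_sum) auto
      with bound[of n "length x"] have "(F n x)\<^sup>2 \<le> M" by simp
      then show ?thesis by (rule real_le_rsqrt)
    next
      case False
      then show ?thesis using M0 by (cases n) (auto simp: F_0 F_Suc)
    qed
    moreover have "F m x \<le> F n x" if "m \<le> n" for m n
      using F_mono that by (rule lift_Suc_mono_le[of "\<lambda>n. F n x"])
    ultimately show ?thesis
      using F_nonneg[of _ x] by (intro Bseq_mono_convergent BseqI'[of _ "sqrt M"]) auto
  qed
  define f where "f x = lim (\<lambda>n. F n x)" for x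
  have lim: "(\<lambda>n. F n x) \<longlonglongrightarrow> f x" for x
    using conv[of x] by (simp add: f_def convergent_LIMSEQ_iff)
  have "f \<in> ell2 (tree d) tree_measure"
  proof (rule ell2_treeI(1))
    fix x assume "x \<notin> tree d"
    then have "F n x = 0" for n by (cases n) (auto simp: F_0 F_Suc)
    then show "f x = 0" by (simp add: f_def)
  next
    fix N
    have "(\<lambda>n. \<Sum>x\<in>tree_ball d N. (F n x)\<^sup>2) \<longlonglongrightarrow> (\<Sum>x\<in>tree_ball d N. (f x)\<^sup>2)"
      by (intro tendsto_intros lim)
    then show "(\<Sum>x\<in>tree_ball d N. (f x)\<^sup>2) \<le> M"
      using bound by (intro LIMSEQ_le_const2) auto
  qed
  moreover have "c * f x = g x + neighbour_sum d f x" if x: "x \<in> tree d" for x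
  proof (rule LIMSEQ_unique)
    show "(\<lambda>n. c * F (Suc n) x) \<longlonglongrightarrow> c * f x"
      by (intro tendsto_intros LIMSEQ_Suc lim)
    have "(\<lambda>n. g x + neighbour_sum d (F n) x) \<longlonglongrightarrow> g x + neighbour_sum d f x"
      unfolding neighbour_sum_def by (intro tendsto_intros lim)
    then show "(\<lambda>n. c * F (Suc n) x) \<longlonglongrightarrow> g x + neighbour_sum d f x"
      using c x by (simp add: F_Suc)
  qed
  ultimately show thesis by (rule that)
qed

lemma resolvent_exists:
  assumes d: "d \<ge> 1" and c: "4 * real d < c\<^sup>2" "c > 0"
    and g: "g \<in> ell2 (tree d) tree_measure"
  obtains f where "f \<in> ell2 (tree d) tree_measure"
    "\<And>x. x \<in> tree d \<Longrightarrow> c * f x = g x + neighbour_sum d f x"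
proof -
  \<comment> \<open>Positive and negative parts of \<open>g\<close>, taken with \<open>s = 1\<close>
    and \<open>s = -1\<close>; linearity recombines the two solutions.\<close>
  have part: "(\<lambda>x. max 0 (s * g x)) \<in> ell2 (tree d) tree_measure" if "s\<^sup>2 = 1" for s
  proof (rule ell2_treeI(1))
    fix N
    have "(max 0 (s * g x))\<^sup>2 \<le> (g x)\<^sup>2" for x
      using that by (auto simp: max_def power_mult_distrib)
    then have "(\<Sum>x\<in>tree_ball d N. (max 0 (s * g x))\<^sup>2) \<le> (\<Sum>x\<in>tree_ball d N. (g x)\<^sup>2)"
      by (intro sum_mono)
    with ell2_treeD(2)[OF g] show "(\<Sum>x\<in>tree_ball d N. (max 0 (s * g x))\<^sup>2) \<le> tree_norm_sq d g"
      by (rule order_trans[rotated])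
  qed (simp add: ell2_treeD(1)[OF g])
  obtain p where p: "p \<in> ell2 (tree d) tree_measure"
    "\<And>x. x \<in> tree d \<Longrightarrow> c * p x = max 0 (1 * g x) + neighbour_sum d p x"
    using resolvent_exists_nonneg[OF d c part[of 1]] by auto
  obtain q where q: "q \<in> ell2 (tree d) tree_measure"
    "\<And>x. x \<in> tree d \<Longrightarrow> c * q x = max 0 (- 1 * g x) + neighbour_sum d q x"
    using resolvent_exists_nonneg[OF d c part[of "- 1"]] by auto
  show thesis
  proof (rule that)
    show "(\<lambda>x. p x - q x) \<in> ell2 (tree d) tree_measure"
      by (rule ell2_tree_diff[OF p(1) q(1)])
    fix x assume x: "x \<in> tree d"
    have "c * (p x - q x) = max 0 (g x) - max 0 (- g x) + (neighbour_sum d p x - neighbour_sum d q x)"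
      using p(2)[OF x] q(2)[OF x] by (simp add: right_diff_distrib)
    also have "max 0 (g x) - max 0 (- g x) = g x" by (simp add: max_def)
    finally show "c * (p x - q x) = g x + neighbour_sum d (\<lambda>x. p x - q x) x"
      by (simp add: neighbour_sum_def sum_subtractf)
  qed
qed

text \<open>The hypothesis on \<open>\<mu>\<close> amounts to \<open>c > 2 * sqrt d\<close>. The a
  priori estimate then gives injectivity and a bounded inverse, the iteration surjectivity.\<close>

lemma below_bottom_not_in_spectrum:
  assumes d: "d \<ge> 1" and \<mu>: "\<mu> < (sqrt (real d) - 1)\<^sup>2"
  shows "\<mu> \<notin> laplacian_spectrum (tree d) tree_edge tree_measure"
proof -
  define c where "c = real d + 1 - \<mu>"
  let ?T = "shifted_laplacian (tree d) tree_edge tree_measure \<mu>"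
  let ?E = "ell2 (tree d) tree_measure"
  have c2: "2 * sqrt (real d) < c"
    using \<mu> by (simp add: c_def power2_diff)
  then have "(2 * sqrt (real d))\<^sup>2 < c\<^sup>2"
    by (intro power_strict_mono) auto
  then have c: "4 * real d < c\<^sup>2" "c > 0"
    using c2 by (auto simp: power_mult_distrib intro: le_less_trans[of 0 "2 * sqrt (real d)"])
  have T: "?T f = (\<lambda>x. if x \<in> tree d then c * f x - neighbour_sum d f x else 0)" for f
    unfolding c_def by (rule shifted_laplacian_tree)
  have bounded: "tree_norm_sq d f \<le> resolvent_const d c / resolvent_delta d c * tree_norm_sq d (?T f)"
    if f: "f \<in> ?E" for f
    by (rule resolvent_a_priori[OF d c(1) f shifted_laplacian_in_ell2[OF d f]]) (simp add: T)
  have "inj_on ?T ?E"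
  proof (rule inj_onI)
    fix f g assume f: "f \<in> ?E" and g: "g \<in> ?E" and fg: "?T f = ?T g"
    let ?h = "\<lambda>x. f x - g x"
    have h: "?h \<in> ?E" by (rule ell2_tree_diff[OF f g])
    have "?T ?h = (\<lambda>x. ?T f x - ?T g x)"
      by (auto simp: T neighbour_sum_def sum_subtractf algebra_simps)
    then have "?T ?h = (\<lambda>x. 0)" using fg by simp
    then have "tree_norm_sq d ?h \<le> 0"
      using bounded[OF h] by (simp add: tree_norm_sq_eq)
    show "f = g"
    proof
      fix x
      show "f x = g x"
      proof (cases "x \<in> tree d")
        case True
        have "(?h x)\<^sup>2 \<le> (\<Sum>x\<in>tree_ball d (length x). (?h x)\<^sup>2)"
          using True by (intro member_le_sum) auto
        also have "\<dots> \<le> tree_norm_sq d ?h" by (rule ell2_treeD(2)[OF h])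
        also have "\<dots> \<le> 0" by fact
        finally show ?thesis by simp
      qed (simp add: ell2_treeD(1)[OF f] ell2_treeD(1)[OF g])
    qed
  qed
  moreover have "?T ` ?E = ?E"
  proof
    show "?T ` ?E \<subseteq> ?E" using shifted_laplacian_in_ell2[OF d] by auto
    show "?E \<subseteq> ?T ` ?E"
    proof
      fix g assume g: "g \<in> ?E"
      obtain f where f: "f \<in> ?E" "\<And>x. x \<in> tree d \<Longrightarrow> c * f x = g x + neighbour_sum d f x"
        using resolvent_exists[OF d c g] by blast
      then have "?T f = g" by (auto simp: T ell2_treeD(1)[OF g])
      with f(1) show "g \<in> ?T ` ?E" by blast
    qed
  qed
  ultimately have "bij_betw ?T ?E ?E" by (simp add: bij_betw_def)
  with bounded show ?thesis unfolding laplacian_spectrum_def by blast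
qed

text \<open>
  Multiplying the radial function \<open>d\<^bsup>-r/2\<^esup>\<close> by a tent of width \<open>2 n\<close> and height \<open>n\<close> gives a function
  of norm at least \<open>n\<close> whose image is carried by the three spheres on which the tent bends.
\<close>

lemma bottom_in_spectrum:
  assumes d: "d \<ge> 1"
  shows "(sqrt (real d) - 1)\<^sup>2 \<in> laplacian_spectrum (tree d) tree_edge tree_measure"
proof (rule ccontr)
  let ?T = "shifted_laplacian (tree d) tree_edge tree_measure ((sqrt (real d) - 1)\<^sup>2)"
  define s where "s = sqrt (real d)"
  have s: "s > 0" "real d = s\<^sup>2" using d by (auto simp: s_def)
  assume "(sqrt (real d) - 1)\<^sup>2 \<notin> laplacian_spectrum (tree d) tree_edge tree_measure"
  then obtain B where B: "\<And>f. f \<in> ell2 (tree d) tree_measure \<Longrightarrow> tree_norm_sq d f \<le> B * tree_norm_sq d (?T f)"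
    by (auto simp: laplacian_spectrum_def)
  have key: "(real n)\<^sup>2 \<le> \<bar>B\<bar> * (12 * real d)" if n: "n \<ge> 1" for n
  proof -
    define g where "g r = max 0 (real n - \<bar>real r - real n\<bar>)" for r :: nat
    \<comment> \<open>The negative second difference of the tent. Dividing by \<open>s ^ r\<close>
      conjugates \<open>2 * s - B\<close> into \<open>s\<close> times it; at the root, where
      \<open>r - 1\<close> is again 0, this still holds because \<open>g 0 = 0\<close>.\<close>
    define D where "D r = 2 * g r - g (r - 1) - g (Suc r)" for r
    define f where "f x = (if x \<in> tree d then g (length x) / s ^ length x else 0)" for x
    have D0: "D r = 0" if "r \<noteq> 0" "r \<noteq> n" "r \<noteq> 2 * n" for r
    proof -
      have r1: "real (r - 1) = real r - 1" using that by (simp add: of_nat_diff)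
      consider "r + 1 \<le> n" "1 \<le> r" | "n + 1 \<le> r" "r + 1 \<le> 2 * n" | "2 * n + 1 \<le> r"
        using \<open>r \<noteq> 0\<close> \<open>r \<noteq> n\<close> \<open>r \<noteq> 2 * n\<close> by arith
      then show ?thesis
        by cases (auto simp: D_def g_def r1 max_def abs_if)
    qed
    have D2: "(D r)\<^sup>2 \<le> 4" for r
    proof -
      have "\<bar>g i - g j\<bar> \<le> 1" if "\<bar>real i - real j\<bar> \<le> 1" for i j
        using that by (auto simp: g_def max_def abs_if split: if_splits)
      from this[of r "r - 1"] this[of r "Suc r"] have "\<bar>D r\<bar> \<le> 2"
        by (cases r) (auto simp: D_def)
      then have "\<bar>D r\<bar>\<^sup>2 \<le> 2\<^sup>2" by (intro power_mono) auto
      then show ?thesis by simp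
    qed
    \<comment> \<open>The tent bends only at 0, \<open>n\<close> and \<open>2 * n\<close>, and each
      bend contributes at most 4.\<close>
    have sumD: "(\<Sum>r\<le>N. (D r)\<^sup>2) \<le> 12" for N
    proof -
      have "(\<Sum>r\<le>N. (D r)\<^sup>2) \<le> (\<Sum>r\<in>{..N} \<union> {0, n, 2 * n}. (D r)\<^sup>2)"
        by (intro sum_mono2) auto
      also have "\<dots> = (\<Sum>r\<in>{0, n, 2 * n}. (D r)\<^sup>2)"
        by (intro sum.mono_neutral_right) (auto simp: D0)
      also have "\<dots> \<le> (\<Sum>r\<in>{0, n, 2 * n}. 4)" by (intro sum_mono D2)
      also have "\<dots> = 12" using n by simp
      finally show ?thesis .
    qed
    have sd: "real d ^ r = (s ^ r)\<^sup>2" for r by (simp add: s(2) flip: power_mult) (simp add: mult.commute)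
    have Tf: "?T f x = s * D (length x) / s ^ length x" if x: "x \<in> tree d" for x
    proof (cases x)
      case Nil
      have "g 0 = 0" by (simp add: g_def)
      with Nil s show ?thesis
        unfolding shifted_laplacian_tree neighbour_sum_def s_def[symmetric]
        by (simp add: f_def D_def power2_eq_square)
    next
      case (Cons a y)
      with x s show ?thesis
        unfolding shifted_laplacian_tree neighbour_sum_def s_def[symmetric]
        by (simp add: f_def D_def power2_eq_square field_simps)
    qed
    have "(\<Sum>x\<in>tree_ball d N. (?T f x)\<^sup>2) \<le> 12 * real d" for N
    proof -
      have "(\<Sum>x\<in>tree_ball d N. (?T f x)\<^sup>2) = (\<Sum>x\<in>tree_ball d N. (s * D (length x) / s ^ length x)\<^sup>2)"
        by (intro sum.cong) (auto simp: Tf)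
      also have "\<dots> = (\<Sum>r\<le>N. real d ^ r * (s * D r / s ^ r)\<^sup>2)"
        by (rule sum_tree_ball_radial)
      also have "\<dots> = (\<Sum>r\<le>N. real d * (D r)\<^sup>2)"
        unfolding sd by (intro sum.cong refl) (use s in \<open>simp add: power_divide power_mult_distrib\<close>)
      also have "\<dots> = real d * (\<Sum>r\<le>N. (D r)\<^sup>2)" by (simp add: sum_distrib_left)
      also have "\<dots> \<le> real d * 12" by (intro mult_left_mono sumD) simp
      finally show ?thesis by simp
    qed
    then have Tnorm: "tree_norm_sq d (?T f) \<le> 12 * real d"
      by (intro ell2_treeI(2)) (simp_all add: shifted_laplacian_def)
    have f_sum: "(\<Sum>x\<in>tree_ball d N. (f x)\<^sup>2) = (\<Sum>r\<le>N. (g r)\<^sup>2)" for N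
    proof -
      have "(\<Sum>x\<in>tree_ball d N. (f x)\<^sup>2) = (\<Sum>x\<in>tree_ball d N. (g (length x) / s ^ length x)\<^sup>2)"
        by (intro sum.cong) (auto simp: f_def)
      also have "\<dots> = (\<Sum>r\<le>N. real d ^ r * (g r / s ^ r)\<^sup>2)"
        by (rule sum_tree_ball_radial)
      also have "\<dots> = (\<Sum>r\<le>N. (g r)\<^sup>2)"
        unfolding sd by (intro sum.cong refl) (use s in \<open>simp add: power_divide\<close>)
      finally show ?thesis .
    qed
    have f: "f \<in> ell2 (tree d) tree_measure"
    proof (rule ell2_treeI(1))
      fix N
      have "(\<Sum>r\<le>N. (g r)\<^sup>2) \<le> (\<Sum>r\<in>{..N} \<union> {..2 * n}. (g r)\<^sup>2)"
        by (intro sum_mono2) auto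
      also have "\<dots> = (\<Sum>r\<le>2 * n. (g r)\<^sup>2)"
        by (intro sum.mono_neutral_right) (auto simp: g_def)
      finally show "(\<Sum>x\<in>tree_ball d N. (f x)\<^sup>2) \<le> (\<Sum>r\<le>2 * n. (g r)\<^sup>2)"
        by (simp add: f_sum)
    qed (simp add: f_def)
    have "(real n)\<^sup>2 = (g n)\<^sup>2" by (simp add: g_def)
    also have "\<dots> \<le> (\<Sum>r\<le>n. (g r)\<^sup>2)" by (intro member_le_sum) auto
    also have "\<dots> \<le> tree_norm_sq d f"
      using ell2_treeD(2)[OF f, of n] by (simp add: f_sum)
    also have "\<dots> \<le> B * tree_norm_sq d (?T f)" by (rule B[OF f])
    also have "\<dots> \<le> \<bar>B\<bar> * (12 * real d)"
      by (intro mult_mono Tnorm) (auto simp: tree_norm_sq_eq intro: infsum_nonneg)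
    finally show ?thesis .
  qed
  obtain n :: nat where n: "\<bar>B\<bar> * (12 * real d) < real n"
    using reals_Archimedean2 by blast
  then have "real n > 0" by (rule le_less_trans[rotated]) simp
  then have n1: "1 \<le> n" by simp
  then have "real n * 1 \<le> real n * real n" by (intro mult_left_mono) auto
  with key[OF n1] n show False by (simp add: power2_eq_square)
qed

lemma lambda0_eq:
  assumes "d \<ge> 1"
  shows "lambda0 d = (sqrt (real d) - 1)\<^sup>2"
  unfolding lambda0_def spectral_bottom_def
  using bottom_in_spectrum[OF assms] below_bottom_not_in_spectrum[OF assms]
  by (intro cInf_eq_minimum) (auto simp: not_less[symmetric])

subsection \<open>The series expansion\<close>

text \<open>Up to sign, the binomial coefficient of 1/2 over \<open>n\<close>, that is, the
  coefficient of \<open>t ^ n\<close> in \<open>sqrt (1 + t)\<close>.\<close>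

definition half_coeff :: "nat \<Rightarrow> real" where
  "half_coeff n = real ((2 * n) choose n) * (1 / (2 ^ (2 * n) * (2 * real n - 1)))"

lemma central_binomial_Suc:
  "Suc n * ((2 * Suc n) choose Suc n) = 2 * (2 * n + 1) * ((2 * n) choose n)"
proof -
  \<comment> \<open>The middle coefficient \<open>B\<close> of the odd row in between links the two
    central ones, by absorption on either side and the symmetry of that row.\<close>
  define A B C where "A = (2 * n) choose n" and "B = Suc (2 * n) choose n"
    and "C = (2 * Suc n) choose Suc n"
  have C: "(2 * Suc n) * B = C * Suc n"
    using Suc_times_binomial_eq[of "Suc (2 * n)" n] by (simp add: B_def C_def del: binomial_Suc_Suc)
  have B: "Suc (2 * n) * A = B * Suc n"
    using Suc_times_binomial_eq[of "2 * n" n] binomial_symmetric[of n "Suc (2 * n)"]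
    by (simp add: A_def B_def del: binomial_Suc_Suc)
  have "Suc n * (C * Suc n) = 2 * Suc n * (B * Suc n)"
    unfolding C[symmetric] by (simp only: mult_ac)
  also have "\<dots> = Suc n * (2 * (Suc (2 * n) * A))"
    unfolding B[symmetric] by (simp only: mult_ac)
  finally have "C * Suc n = 2 * (Suc (2 * n) * A)"
    by (simp only: mult_cancel1) simp
  then show ?thesis
    unfolding A_def C_def by (simp only: mult_ac Suc_eq_plus1)
qed

text \<open>Both sides satisfy the recursion with factor \<open>(1/2 - n) / (n + 1)\<close>. The
  denominator \<open>2 * n - 1\<close> never vanishes, by parity.\<close>

lemma gbinomial_half: "(1 / 2 :: real) gchoose n = (-1) ^ Suc n * half_coeff n"
proof (induction n)
  case 0
  show ?case by (simp add: half_coeff_def)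
next
  case (Suc n)
  define C where "C = real ((2 * n) choose n)"
  have nz: "2 * real n - 1 \<noteq> 0"
  proof
    assume "2 * real n - 1 = 0"
    then have "real (2 * n) = real 1" by simp
    then have "2 * n = 1" by (simp only: of_nat_eq_iff)
    then show False by presburger
  qed
  have "real (Suc n) * (1 / 2 gchoose Suc n) = (1 / 2 - real n) * (1 / 2 gchoose n)"
    using gbinomial_mult_1[of "1 / 2 :: real" n] by (simp add: algebra_simps)
  also have "\<dots> = (1 / 2 - real n) * ((-1) ^ Suc n * (C * (1 / (2 ^ (2 * n) * (2 * real n - 1)))))"
    by (simp only: Suc.IH half_coeff_def C_def)
  also have "\<dots> = (-1) ^ n * C / (2 * 2 ^ (2 * n))"
    using nz by (simp add: field_simps)
  finally have lhs: "real (Suc n) * (1 / 2 gchoose Suc n) = (-1) ^ n * C / (2 * 2 ^ (2 * n))" .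
  have "real (Suc n) * real ((2 * Suc n) choose Suc n) = 2 * (2 * real n + 1) * C"
    unfolding C_def of_nat_mult[symmetric] central_binomial_Suc by (simp add: algebra_simps)
  moreover have "real (Suc n) * ((-1) ^ Suc (Suc n) * half_coeff (Suc n)) =
      (-1) ^ n * (real (Suc n) * real ((2 * Suc n) choose Suc n)) / (4 * 2 ^ (2 * n) * (2 * real n + 1))"
    by (simp add: half_coeff_def algebra_simps del: binomial_Suc_Suc)
  ultimately have "real (Suc n) * ((-1) ^ Suc (Suc n) * half_coeff (Suc n)) =
      (-1) ^ n * (2 * (2 * real n + 1) * C) / (4 * 2 ^ (2 * n) * (2 * real n + 1))"
    by simp
  also have "\<dots> = (-1) ^ n * C / (2 * 2 ^ (2 * n))"
    by (simp add: divide_simps)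
  finally have "real (Suc n) * (1 / 2 gchoose Suc n) = real (Suc n) * ((-1) ^ Suc (Suc n) * half_coeff (Suc n))"
    unfolding lhs by simp
  then show ?case by (subst (asm) mult_cancel_left) simp
qed

text \<open>Adding the binomial series at \<open>t\<close> and \<open>- t\<close> cancels the odd
  terms. Removing the terms \<open>-1\<close> at \<open>n = 0\<close> and \<open>t^2 / 8\<close> at
  \<open>n = 2\<close> leaves nonnegative ones, so convergence in order is unconditional
  summability.\<close>

lemma sqrt_pair_has_sum:
  fixes t :: real
  assumes t: "0 \<le> t" "t < 1"
  shows "((\<lambda>n. half_coeff n * t ^ n) has_sum
    ((2 - sqrt (1 - t) - sqrt (1 + t) - t\<^sup>2 / 4) / 2)) {n. even n \<and> n \<ge> 4}"
proof -
  have plus: "(\<lambda>n. (1 / 2 gchoose n) * t ^ n) sums sqrt (1 + t)"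
    using gen_binomial_real[of t "1 / 2"] t by (simp add: powr_half_sqrt)
  have minus: "(\<lambda>n. (1 / 2 gchoose n) * (- t) ^ n) sums sqrt (1 - t)"
    using gen_binomial_real[of "- t" "1 / 2"] t by (simp add: powr_half_sqrt)
  let ?h = "\<lambda>n. if even n then half_coeff n * t ^ n else 0"
  have "(\<lambda>n. ((1 / 2 gchoose n) * t ^ n + (1 / 2 gchoose n) * (- t) ^ n) * (- 1 / 2)) sums
      ((sqrt (1 + t) + sqrt (1 - t)) * (- 1 / 2))"
    by (intro sums_mult2 sums_add plus minus)
  also have "(\<lambda>n. ((1 / 2 gchoose n) * t ^ n + (1 / 2 gchoose n) * (- t) ^ n) * (- 1 / 2)) = ?h"
    by (auto simp: gbinomial_half)
  finally have h: "?h sums ((sqrt (1 + t) + sqrt (1 - t)) * (- 1 / 2))" .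
  have "(\<lambda>n. if n \<in> {0, 2} then ?h n else 0) sums (\<Sum>n\<in>{0, 2}. ?h n)"
    by (rule sums_If_finite_set) simp
  also have "(\<Sum>n\<in>{0, 2}. ?h n) = t\<^sup>2 / 8 - 1"
    by (simp add: half_coeff_def numeral_2_eq_2)
  finally have "(\<lambda>n. ?h n - (if n \<in> {0, 2} then ?h n else 0)) sums
      ((sqrt (1 + t) + sqrt (1 - t)) * (- 1 / 2) - (t\<^sup>2 / 8 - 1))"
    by (intro sums_diff h)
  also have "(\<lambda>n. ?h n - (if n \<in> {0, 2} then ?h n else 0)) =
      (\<lambda>n. if even n \<and> n \<ge> 4 then half_coeff n * t ^ n else 0)"
  proof
    fix n :: nat
    have "n = 0 \<or> n = 2 \<or> odd n \<or> even n \<and> n \<ge> 4"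
      by presburger
    then consider "n = 0" | "n = 2" | "odd n" | "even n" "n \<ge> 4"
      by blast
    then show "?h n - (if n \<in> {0, 2} then ?h n else 0) =
        (if even n \<and> n \<ge> 4 then half_coeff n * t ^ n else 0)"
      by cases auto
  qed
  also have "(sqrt (1 + t) + sqrt (1 - t)) * (- 1 / 2) - (t\<^sup>2 / 8 - 1) =
      (2 - sqrt (1 - t) - sqrt (1 + t) - t\<^sup>2 / 4) / 2"
    by (simp add: field_simps)
  finally have "((\<lambda>n. if even n \<and> n \<ge> 4 then half_coeff n * t ^ n else 0) has_sum
      ((2 - sqrt (1 - t) - sqrt (1 + t) - t\<^sup>2 / 4) / 2)) UNIV"
    by (rule sums_nonneg_imp_has_sum) (use t in \<open>auto simp: half_coeff_def\<close>)
  also have "?this \<longleftrightarrow> ?thesis"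
    by (rule has_sum_cong_neutral) auto
  finally show ?thesis .
qed


subsection \<open>The optimal Hardy weight\<close>

lemma weighted_norm_sq_cong:
  "(\<And>x. x \<in> X \<Longrightarrow> w x = w' x) \<Longrightarrow> weighted_norm_sq X m w = weighted_norm_sq X m w'"
  by (auto simp: weighted_norm_sq_def fun_eq_iff intro!: infsum_cong)

text \<open>Distance from the root and word length agree only on the tree, so optimality must be
  seen to depend on the weight there alone.\<close>

lemma optimal_hardy_weight_cong:
  assumes w: "\<And>x. x \<in> X \<Longrightarrow> w x = w' x" and \<Omega>: "\<Omega> \<subseteq> X"
  shows "optimal_hardy_weight X b m \<Omega> w \<longleftrightarrow> optimal_hardy_weight X b m \<Omega> w'"
proof -
  have w\<Omega>: "w x = w' x" if "x \<in> \<Omega>" for x using w \<Omega> that by auto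
  have "positive_superharmonic X b m \<Omega> w = positive_superharmonic X b m \<Omega> w'"
    by (auto simp: positive_superharmonic_def superharmonic_on_def w\<Omega> fun_eq_iff)
  then have agmon: "agmon_ground_state X b m \<Omega> w = agmon_ground_state X b m \<Omega> w'"
    by (simp add: agmon_ground_state_def fun_eq_iff)
  have "(\<lambda>x. (u x)\<^sup>2 * w x * m x) summable_on \<Omega> \<longleftrightarrow> (\<lambda>x. (u x)\<^sup>2 * w' x * m x) summable_on \<Omega>" for u
    by (intro summable_on_cong) (simp add: w\<Omega>)
  with agmon have "critical X b m \<Omega> w \<longleftrightarrow> critical X b m \<Omega> w'"
    "null_critical X b m \<Omega> w \<longleftrightarrow> null_critical X b m \<Omega> w'"
    by (simp_all add: critical_def null_critical_def)
  moreover have "weighted_norm_sq X m (\<lambda>x. k * w x) = weighted_norm_sq X m (\<lambda>x. k * w' x)" for k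
    using w by (intro weighted_norm_sq_cong) simp
  then have "optimal_near_infinity X b m \<Omega> w \<longleftrightarrow> optimal_near_infinity X b m \<Omega> w'"
    by (simp add: optimal_near_infinity_def)
  moreover have "weighted_norm_sq X m w = weighted_norm_sq X m w'"
    by (rule weighted_norm_sq_cong[OF w])
  then have "hardy_weight X b m \<Omega> w \<longleftrightarrow> hardy_weight X b m \<Omega> w'"
    by (auto simp: hardy_weight_def w\<Omega>)
  ultimately show ?thesis by (simp add: optimal_hardy_weight_def)
qed

lemma optimal_hardy_weight_tree:
  assumes d: "d \<ge> 1"
  shows "optimal_hardy_weight (tree d) tree_edge tree_measure (tree d - {[]})
    (\<lambda>x. hardy_profile d (length x))"
  unfolding optimal_hardy_weight_def
proof (intro conjI)
  have pos: "0 < hardy_profile d (length x)" if "x \<noteq> []" for x :: "nat list"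
    using that d by (intro hardy_profile_pos) (auto simp: Suc_le_eq)
  moreover have "[0] \<in> tree d - {[]}" using d by simp
  ultimately have "\<exists>x\<in>tree d - {[]}. hardy_profile d (length x) \<noteq> 0"
    by (metis list.distinct(1) less_irrefl)
  with pos show "hardy_weight (tree d) tree_edge tree_measure (tree d - {[]})
      (\<lambda>x. hardy_profile d (length x))"
    using hardy_inequality[OF d] by (auto simp: hardy_weight_def less_imp_le)
  show "null_critical (tree d) tree_edge tree_measure (tree d - {[]}) (\<lambda>x. hardy_profile d (length x))"
    by (rule null_critical_tree[OF d])
  then show "critical (tree d) tree_edge tree_measure (tree d - {[]}) (\<lambda>x. hardy_profile d (length x))"
    by (simp add: null_critical_def)
  show "optimal_near_infinity (tree d) tree_edge tree_measure (tree d - {[]})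
      (\<lambda>x. hardy_profile d (length x))"
    by (rule optimal_near_infinity_tree[OF d])
qed

theorem theorem3p4:
  fixes d :: nat
  assumes "d \<ge> 1"
  shows "(\<forall>\<phi>\<in>Cc (tree d - {tree_root}).
            energy (tree d) tree_edge \<phi>
              \<ge> weighted_norm_sq (tree d) tree_measure (\<lambda>x. w0 d (tree_radius d x)) \<phi>) \<and>
         optimal_hardy_weight (tree d) tree_edge tree_measure (tree d - {tree_root})
           (\<lambda>x. w0 d (tree_radius d x)) \<and>
         (\<forall>r::nat. r \<ge> 2 \<longrightarrow>
            (\<lambda>n::nat. real ((2 * n) choose n) * (1 / (2 ^ (2 * n) * (2 * real n - 1))) * (1 / real r ^ n))
              summable_on {n. even n \<and> n \<ge> 4} \<and>
            w0 d r = lambda0 d + sqrt d / (4 * real r ^ 2) +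
              2 * sqrt d * (\<Sum>\<^sub>\<infinity>n\<in>{n::nat. even n \<and> n \<ge> 4}.
                real ((2 * n) choose n) * (1 / (2 ^ (2 * n) * (2 * real n - 1))) * (1 / real r ^ n)))"
proof -
  have w0: "w0 d = hardy_profile d"
    using assms by (simp add: fun_eq_iff w0_def hardy_profile_def lambda0_eq)
  have optimal: "optimal_hardy_weight (tree d) tree_edge tree_measure (tree d - {tree_root})
      (\<lambda>x. w0 d (tree_radius d x))"
    by (subst optimal_hardy_weight_cong[where w' = "\<lambda>x. hardy_profile d (length x)"])
       (use assms in \<open>auto simp: w0 tree_radius_eq_length intro: optimal_hardy_weight_tree\<close>)
  moreover have "\<forall>\<phi>\<in>Cc (tree d - {tree_root}). energy (tree d) tree_edge \<phi>
      \<ge> weighted_norm_sq (tree d) tree_measure (\<lambda>x. w0 d (tree_radius d x)) \<phi>"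
    using optimal by (simp add: optimal_hardy_weight_def hardy_weight_def)
  moreover have "(\<lambda>n::nat. real ((2 * n) choose n) * (1 / (2 ^ (2 * n) * (2 * real n - 1))) * (1 / real r ^ n))
        summable_on {n. even n \<and> n \<ge> 4} \<and>
      w0 d r = lambda0 d + sqrt d / (4 * real r ^ 2) +
        2 * sqrt d * (\<Sum>\<^sub>\<infinity>n\<in>{n::nat. even n \<and> n \<ge> 4}.
          real ((2 * n) choose n) * (1 / (2 ^ (2 * n) * (2 * real n - 1))) * (1 / real r ^ n))"
    if "r \<ge> 2" for r :: nat
  proof -
    \<comment> \<open>The expansion at \<open>t = 1/r\<close>, which lies below 1 as
      \<open>r \<ge> 2\<close>; the split-off term \<open>t^2 / 4\<close> becomes
      \<open>sqrt d / (4 * r^2)\<close>.\<close>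
    have "((\<lambda>n::nat. real ((2 * n) choose n) * (1 / (2 ^ (2 * n) * (2 * real n - 1))) * (1 / real r ^ n))
      has_sum ((2 - sqrt (1 - 1 / real r) - sqrt (1 + 1 / real r) - (1 / real r)\<^sup>2 / 4) / 2))
      {n. even n \<and> n \<ge> 4}"
      using sqrt_pair_has_sum[of "1 / real r"] that by (simp add: half_coeff_def power_one_over)
    then show ?thesis
      unfolding w0_def by (subst infsumI, assumption)
        (auto simp: power_divide right_diff_distrib diff_divide_distrib dest: has_sum_imp_summable)
  qed
  ultimately show ?thesis by blast
qed

end
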